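(* Let $a,b,c,q,D_0$ be real constants, $T>0$, $x^0_0,x_0\in\mathbb R$, and $W^0$ a one-dimensional Wiener process with filtration $(\mathcal F^0_t)$ on $(\Omega,\mathcal F,\mathbb P)$. Let $(X^0,\bar X,\bar P^0,\bar P,\bar Q^{00},\bar Q^{10})$ be the solution of $$\begin{cases} dX^0_t=(a\bar X_t-\frac12b^2\bar P^0_t)dt+D_0dW^0_t, & X^0_0=x^0_0, \\ d\bar X_t=cX^0_tdt, & \bar X_0=x_0, \\ d\bar P^0_t=-(2qX^0_t+c\bar P_t)dt+\bar Q^{00}_tdW^0_t, & \bar P^0_T=0, \\ d\bar P_t=-a\bar P^0_tdt+\bar Q^{10}_tdW^0_t, & \bar P_T=0,\end{cases}$$ and let $(\mathsf X^0,\bar{\mathsf X},Y^0,Z^0)$ be the solution of $$\begin{cases} d\mathsf X^0_t=(a\bar{\mathsf X}_t-\frac12b^2Y^0_t)dt+D_0dW^0_t, & \mathsf X^0_0=x^0_0, \\ d\bar{\mathsf X}_t=c\mathsf X^0_tdt, & \bar{\mathsf X}_0=x_0, \\ dY^0_t=-2q\mathsf X^0_tdt+Z^0_tdW^0_t, & Y^0_T=0.\end{cases}$$ Then there exist $t\in[0,T]$ and an event $E\subset\Omega$ such that $\mathbb P(E)>0$ and, on $E$, $\bar P^0_t\neq Y^0_t$.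
   Context: All processes are real-valued and progressively measurable with respect to $(\mathcal F^0_t)$. The first system characterizes the major player's optimal control $-\frac b2\bar P^0$ in the conditional McKean–Vlasov scheme for the game with major state $dX^0_t=(a\,\mathbb E[X_t|\mathcal F^0_t]+bu^0_t)dt+D_0dW^0_t$, minor state $dX_t=cX^0_tdt+DdW_t$ ($W$ a Wiener process independent of $W^0$, $D$ a constant) and major cost $\mathbb E\int_0^T[q(X^0_t)^2+(u^0_t)^2]dt$, where $\bar X_t=\mathbb E[X_t|\mathcal F^0_t]$. The second characterizes the control $-\frac b2Y^0$ obtained when the conditional mean is first fixed exogenously in the major player's optimization and only then matched to $\mathbb E[X_t|\mathcal F^0_t]$.
   Formalization: The formal statement assumes a, c, q are nonzero and D_0, x^0_0, x_0 are not all zero; otherwise the two adjoint processes coincide and the claim fails. Solutions are taken to be square integrable on [0,T]. *)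

theory Defs
  imports "HOL-Probability.Probability"
begin

section \<open>Wiener processes and progressive measurability\<close>

text \<open>
  Time is indexed by \<^typ>\<open>real\<close>; only \<open>t \<ge> 0\<close> is relevant (a filtration given for \<open>t \<ge> 0\<close> may be
  extended by \<open>F t = F 0\<close> for \<open>t < 0\<close>). The filtration need not be generated by \<open>W\<close>: the natural
  filtration of \<open>W\<close> and its augmentation by null sets are both instances.
\<close>

definition wiener_process :: "'w measure \<Rightarrow> (real \<Rightarrow> 'w measure) \<Rightarrow> (real \<Rightarrow> 'w \<Rightarrow> real) \<Rightarrow> bool" where
  "wiener_process M F W \<longleftrightarrow>
     prob_space M \<and> filtration (space M) F \<and> (\<forall>t\<ge>0. subalgebra M (F t)) \<and>
     (\<forall>t\<ge>0. W t \<in> borel_measurable (F t)) \<and>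
     (AE \<omega> in M. W 0 \<omega> = 0) \<and>
     (AE \<omega> in M. continuous_on {0..} (\<lambda>t. W t \<omega>)) \<and>
     (\<forall>s t. 0 \<le> s \<and> s < t \<longrightarrow>
        prob_space.indep_set M (sets (F s))
          (sets (vimage_algebra (space M) (\<lambda>\<omega>. W t \<omega> - W s \<omega>) borel)) \<and>
        distributed M lborel (\<lambda>\<omega>. W t \<omega> - W s \<omega>) (normal_density 0 (sqrt (t - s))))"

definition progressively_measurable :: "(real \<Rightarrow> 'w measure) \<Rightarrow> real \<Rightarrow> (real \<Rightarrow> 'w \<Rightarrow> real) \<Rightarrow> bool" where
  "progressively_measurable F T X \<longleftrightarrow>
     (\<forall>t\<in>{0..T}. (\<lambda>(s, \<omega>). X s \<omega>) \<in> borel_measurable (restrict_space borel {0..t} \<Otimes>\<^sub>M F t))"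

definition L2_dist :: "'w measure \<Rightarrow> real \<Rightarrow> (real \<Rightarrow> 'w \<Rightarrow> real) \<Rightarrow> (real \<Rightarrow> 'w \<Rightarrow> real) \<Rightarrow> ennreal" where
  "L2_dist M T X Y =
     (\<integral>\<^sup>+\<omega>. (\<integral>\<^sup>+t\<in>{0..T}. ennreal ((X t \<omega> - Y t \<omega>)\<^sup>2) \<partial>lborel) \<partial>M)"

definition square_integrable_progressive ::
    "'w measure \<Rightarrow> (real \<Rightarrow> 'w measure) \<Rightarrow> real \<Rightarrow> (real \<Rightarrow> 'w \<Rightarrow> real) \<Rightarrow> bool" where
  "square_integrable_progressive M F T X \<longleftrightarrow>
     progressively_measurable F T X \<and> L2_dist M T X (\<lambda>t \<omega>. 0) < \<infinity>"


section \<open>The Ito integral\<close>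

text \<open>
  A simple integrand is given by a partition \<open>0 = \<tau> 0 < \<dots> < \<tau> n = T\<close> and bounded random
  variables \<open>\<xi> i\<close>, where \<open>\<xi> i\<close> is known at time \<open>\<tau> i\<close>.
\<close>

definition simple_data ::
    "'w measure \<Rightarrow> (real \<Rightarrow> 'w measure) \<Rightarrow> real \<Rightarrow> nat \<Rightarrow> (nat \<Rightarrow> real) \<Rightarrow> (nat \<Rightarrow> 'w \<Rightarrow> real) \<Rightarrow> bool" where
  "simple_data M F T n \<tau> \<xi> \<longleftrightarrow>
     strict_mono_on {0..n} \<tau> \<and> \<tau> 0 = 0 \<and> \<tau> n = T \<and>
     (\<forall>i<n. \<xi> i \<in> borel_measurable (F (\<tau> i))) \<and>
     (\<exists>C. \<forall>i<n. \<forall>\<omega>\<in>space M. \<bar>\<xi> i \<omega>\<bar> \<le> C)"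

definition simple_process :: "nat \<Rightarrow> (nat \<Rightarrow> real) \<Rightarrow> (nat \<Rightarrow> 'w \<Rightarrow> real) \<Rightarrow> real \<Rightarrow> 'w \<Rightarrow> real" where
  "simple_process n \<tau> \<xi> t \<omega> = (\<Sum>i<n. \<xi> i \<omega> * indicator {\<tau> i<..\<tau> (Suc i)} t)"

definition simple_integral ::
    "(real \<Rightarrow> 'w \<Rightarrow> real) \<Rightarrow> nat \<Rightarrow> (nat \<Rightarrow> real) \<Rightarrow> (nat \<Rightarrow> 'w \<Rightarrow> real) \<Rightarrow> real \<Rightarrow> 'w \<Rightarrow> real" where
  "simple_integral W n \<tau> \<xi> t \<omega> =
     (\<Sum>i<n. \<xi> i \<omega> * (W (min t (\<tau> (Suc i))) \<omega> - W (min t (\<tau> i)) \<omega>))"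

text \<open>
  \<open>I\<close> is a continuous version of \<open>\<integral>\<^sub>0\<^sup>t H dW\<close>, \<open>t \<in> [0,T]\<close>. The integral is determined only up to
  indistinguishability, hence the formulation as a relation.
\<close>

definition has_ito_integral ::
    "'w measure \<Rightarrow> (real \<Rightarrow> 'w measure) \<Rightarrow> (real \<Rightarrow> 'w \<Rightarrow> real) \<Rightarrow> real
      \<Rightarrow> (real \<Rightarrow> 'w \<Rightarrow> real) \<Rightarrow> (real \<Rightarrow> 'w \<Rightarrow> real) \<Rightarrow> bool" where
  "has_ito_integral M F W T H I \<longleftrightarrow>
     square_integrable_progressive M F T H \<and>
     (\<forall>t\<in>{0..T}. I t \<in> borel_measurable M) \<and>
     (AE \<omega> in M. continuous_on {0..T} (\<lambda>t. I t \<omega>)) \<and>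
     (\<exists>n \<tau> \<xi>.
        (\<forall>k. simple_data M F T (n k) (\<tau> k) (\<xi> k)) \<and>
        (\<lambda>k. L2_dist M T H (simple_process (n k) (\<tau> k) (\<xi> k))) \<longlonglongrightarrow> 0 \<and>
        (\<forall>t\<in>{0..T}.
          (\<lambda>k. \<integral>\<^sup>+\<omega>. ennreal ((I t \<omega> - simple_integral W (n k) (\<tau> k) (\<xi> k) t \<omega>)\<^sup>2) \<partial>M)
            \<longlonglongrightarrow> 0))"

text \<open>\<open>dX\<^sub>t = f\<^sub>t dt + H\<^sub>t dW\<^sub>t\<close> on \<open>[0,T]\<close>.\<close>

definition has_ito_differential ::
    "'w measure \<Rightarrow> (real \<Rightarrow> 'w measure) \<Rightarrow> (real \<Rightarrow> 'w \<Rightarrow> real) \<Rightarrow> real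
      \<Rightarrow> (real \<Rightarrow> 'w \<Rightarrow> real) \<Rightarrow> (real \<Rightarrow> 'w \<Rightarrow> real) \<Rightarrow> (real \<Rightarrow> 'w \<Rightarrow> real) \<Rightarrow> bool" where
  "has_ito_differential M F W T X f H \<longleftrightarrow>
     (\<exists>I. has_ito_integral M F W T H I \<and>
       (AE \<omega> in M. set_integrable lborel {0..T} (\<lambda>s. f s \<omega>) \<and>
          (\<forall>t\<in>{0..T}. X t \<omega> = X 0 \<omega> + (LBINT s:{0..t}. f s \<omega>) + I t \<omega>)))"


section \<open>The two forward-backward systems\<close>

text \<open>
  Solutions are taken in the usual class of square integrable progressively measurable processes;
  without an integrability requirement on the martingale parts, solutions of backward equations are
  not unique.
\<close>

definition conditional_mkv_solution ::
    "'w measure \<Rightarrow> (real \<Rightarrow> 'w measure) \<Rightarrow> (real \<Rightarrow> 'w \<Rightarrow> real) \<Rightarrow> real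
      \<Rightarrow> real \<Rightarrow> real \<Rightarrow> real \<Rightarrow> real \<Rightarrow> real \<Rightarrow> real \<Rightarrow> real
      \<Rightarrow> (real \<Rightarrow> 'w \<Rightarrow> real) \<Rightarrow> (real \<Rightarrow> 'w \<Rightarrow> real) \<Rightarrow> (real \<Rightarrow> 'w \<Rightarrow> real) \<Rightarrow> (real \<Rightarrow> 'w \<Rightarrow> real)
      \<Rightarrow> (real \<Rightarrow> 'w \<Rightarrow> real) \<Rightarrow> (real \<Rightarrow> 'w \<Rightarrow> real) \<Rightarrow> bool" where
  "conditional_mkv_solution M F W T a b c q D0 x00 x0 X0 Xbar P0 Pbar Q00 Q10 \<longleftrightarrow>
     (\<forall>Z\<in>{X0, Xbar, P0, Pbar, Q00, Q10}. square_integrable_progressive M F T Z) \<and>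
     has_ito_differential M F W T X0 (\<lambda>t \<omega>. a * Xbar t \<omega> - 1/2 * b\<^sup>2 * P0 t \<omega>) (\<lambda>t \<omega>. D0) \<and>
     has_ito_differential M F W T Xbar (\<lambda>t \<omega>. c * X0 t \<omega>) (\<lambda>t \<omega>. 0) \<and>
     has_ito_differential M F W T P0 (\<lambda>t \<omega>. - (2 * q * X0 t \<omega> + c * Pbar t \<omega>)) Q00 \<and>
     has_ito_differential M F W T Pbar (\<lambda>t \<omega>. - a * P0 t \<omega>) Q10 \<and>
     (AE \<omega> in M. X0 0 \<omega> = x00 \<and> Xbar 0 \<omega> = x0 \<and> P0 T \<omega> = 0 \<and> Pbar T \<omega> = 0)"

definition exogenous_mean_solution ::
    "'w measure \<Rightarrow> (real \<Rightarrow> 'w measure) \<Rightarrow> (real \<Rightarrow> 'w \<Rightarrow> real) \<Rightarrow> real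
      \<Rightarrow> real \<Rightarrow> real \<Rightarrow> real \<Rightarrow> real \<Rightarrow> real \<Rightarrow> real \<Rightarrow> real
      \<Rightarrow> (real \<Rightarrow> 'w \<Rightarrow> real) \<Rightarrow> (real \<Rightarrow> 'w \<Rightarrow> real) \<Rightarrow> (real \<Rightarrow> 'w \<Rightarrow> real) \<Rightarrow> (real \<Rightarrow> 'w \<Rightarrow> real) \<Rightarrow> bool" where
  "exogenous_mean_solution M F W T a b c q D0 x00 x0 X0 Xbar Y0 Z0 \<longleftrightarrow>
     (\<forall>Z\<in>{X0, Xbar, Y0, Z0}. square_integrable_progressive M F T Z) \<and>
     has_ito_differential M F W T X0 (\<lambda>t \<omega>. a * Xbar t \<omega> - 1/2 * b\<^sup>2 * Y0 t \<omega>) (\<lambda>t \<omega>. D0) \<and>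
     has_ito_differential M F W T Xbar (\<lambda>t \<omega>. c * X0 t \<omega>) (\<lambda>t \<omega>. 0) \<and>
     has_ito_differential M F W T Y0 (\<lambda>t \<omega>. - 2 * q * X0 t \<omega>) Z0 \<and>
     (AE \<omega> in M. X0 0 \<omega> = x00 \<and> Xbar 0 \<omega> = x0 \<and> Y0 T \<omega> = 0)"

end

theory Submission
  imports Defs
begin

text \<open>
  If \<open>P0 t = Y0 t\<close> almost surely for every \<open>t\<close>, then the drifts of the two processes agree, since a
  martingale that is the time integral of a square integrable process is constant. This gives
  \<open>c Pbar + 2 q (X0 - X0') = 0\<close>. Comparing drifts once more gives \<open>- c P0 + 2 q (Xbar - Xbar') = 0\<close>, and
  a third time, together with the first identity, \<open>X0 = 0\<close>. The drift of \<open>X0\<close> then vanishes, and one or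
  two further comparisons give \<open>Xbar = 0\<close>. Hence both initial values are zero, and so is the
  martingale \<open>\<integral> D0 dW\<close>, which forces \<open>D0 = 0\<close>.
\<close>

section \<open>Square integrable functions\<close>

text \<open>An Ito integral is given here only as an L2 limit along some sequence of simple
  integrands, its values are only known to be \<open>M\<close>-measurable, and the filtration need
  not contain the null sets. So the integral is not at hand as an adapted martingale. What survives
  is that its increments are orthogonal to every square integrable variable known at the earlier
  time, and this is stable under L2 limits and linear combinations. It suffices for comparing
  drifts: when a process vanishes, its martingale part is, up to null sets, minus the time integral
  of its drift, and that time integral is adapted by progressive measurability, so it can itself
  serve as the test variable. Each comparison turns a linear relation between state and adjoint
  processes into another linear relation between such processes, whose drifts are again continuous;
  this is why it can be repeated.\<close>

definition sqint :: "'a measure \<Rightarrow> ('a \<Rightarrow> real) \<Rightarrow> bool" where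
  "sqint M f \<longleftrightarrow> f \<in> borel_measurable M \<and> integrable M (\<lambda>x. (f x)\<^sup>2)"

lemma sqint_measurable [measurable_dest]: "sqint M f \<Longrightarrow> f \<in> borel_measurable M"
  by (simp add: sqint_def)

lemma sqint_integrable_square: "sqint M f \<Longrightarrow> integrable M (\<lambda>x. (f x)\<^sup>2)"
  by (simp add: sqint_def)

lemma sqint_integrable_mult:
  assumes "sqint M f" "sqint M g"
  shows "integrable M (\<lambda>x. f x * g x)"
proof (rule Bochner_Integration.integrable_bound)
  show "integrable M (\<lambda>x. (f x)\<^sup>2 + (g x)\<^sup>2)"
    using assms by (auto simp: sqint_def)
  show "(\<lambda>x. f x * g x) \<in> borel_measurable M"
    using assms by (auto simp: sqint_def)
  have "\<bar>y * z\<bar> \<le> y\<^sup>2 + z\<^sup>2" for y z :: real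
    using sum_squares_bound[of "\<bar>y\<bar>" "\<bar>z\<bar>"] zero_le_power2[of y] zero_le_power2[of z]
      mult_nonneg_nonneg[of "\<bar>y\<bar>" "\<bar>z\<bar>"]
    unfolding abs_mult mult.assoc power2_abs by linarith
  then show "AE x in M. norm (f x * g x) \<le> norm ((f x)\<^sup>2 + (g x)\<^sup>2)"
    by simp
qed

lemma sqint_cmult: "sqint M f \<Longrightarrow> sqint M (\<lambda>x. r * f x)"
  by (auto simp: sqint_def power_mult_distrib)

lemma sqint_add:
  assumes "sqint M f" "sqint M g"
  shows "sqint M (\<lambda>x. f x + g x)"
  using assms sqint_integrable_mult[OF assms]
  by (auto simp: sqint_def power2_sum mult.assoc)

lemma sqint_diff: "sqint M f \<Longrightarrow> sqint M g \<Longrightarrow> sqint M (\<lambda>x. f x - g x)"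
  using sqint_add[of M f "\<lambda>x. - 1 * g x"] sqint_cmult[of M g "- 1"] by simp

lemma sqint_sum: "(\<And>i. i \<in> I \<Longrightarrow> sqint M (f i)) \<Longrightarrow> sqint M (\<lambda>x. \<Sum>i\<in>I. f i x)"
  by (induction I rule: infinite_finite_induct) (auto intro!: sqint_add simp: sqint_def[of M "\<lambda>x. 0"])

lemma (in finite_measure) sqint_integrable: "sqint M f \<Longrightarrow> integrable M f"
  unfolding sqint_def by (blast intro: square_integrable_imp_integrable)

lemma sqint_AE_cong:
  assumes "sqint M f" "g \<in> borel_measurable M" "AE x in M. f x = g x"
  shows "sqint M g"
  unfolding sqint_def
proof
  show "integrable M (\<lambda>x. (g x)\<^sup>2)"
    by (rule integrable_cong_AE_imp[OF sqint_integrable_square[OF assms(1)]])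
       (use assms in \<open>auto simp: sqint_def elim: eventually_mono\<close>)
qed fact

text \<open>The integral of \<open>(f + r g)\<^sup>2\<close> is a nonnegative quadratic in
  \<open>r\<close>; its value at the minimiser \<open>- ?B / ?C\<close> gives the bound. If
  \<open>?C = 0\<close> it is affine in \<open>r\<close>, so its slope must vanish.\<close>

lemma sqint_Cauchy_Schwarz:
  assumes "sqint M f" "sqint M g"
  shows "(\<integral>x. f x * g x \<partial>M)\<^sup>2 \<le> (\<integral>x. (f x)\<^sup>2 \<partial>M) * (\<integral>x. (g x)\<^sup>2 \<partial>M)"
proof -
  let ?A = "\<integral>x. (f x)\<^sup>2 \<partial>M" and ?B = "\<integral>x. f x * g x \<partial>M" and ?C = "\<integral>x. (g x)\<^sup>2 \<partial>M"
  note int = sqint_integrable_square[OF assms(1)] sqint_integrable_square[OF assms(2)]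
    sqint_integrable_mult[OF assms]
  have quad: "0 \<le> ?A + 2 * r * ?B + r\<^sup>2 * ?C" for r
  proof -
    have "0 \<le> (\<integral>x. (f x + r * g x)\<^sup>2 \<partial>M)"
      by simp
    also have "\<dots> = (\<integral>x. (f x)\<^sup>2 + 2 * r * (f x * g x) + r\<^sup>2 * (g x)\<^sup>2 \<partial>M)"
      by (simp add: power2_sum algebra_simps power_mult_distrib)
    also have "\<dots> = ?A + 2 * r * ?B + r\<^sup>2 * ?C"
      using int by (simp)
    finally show ?thesis .
  qed
  have A0: "0 \<le> ?A" and C0: "0 \<le> ?C" by simp_all
  show ?thesis
  proof (cases "?C = 0")
    case True
    have "?B = 0"
    proof (rule ccontr)
      assume B: "?B \<noteq> 0"
      \<comment> \<open>This \<open>r\<close> gives the affine function the value -1.\<close>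
      show False
        using quad[of "- (?A + 1) / (2 * ?B)"] True B A0 by (simp add: field_simps)
    qed
    then show ?thesis using True by simp
  next
    case False
    have "0 \<le> ?C * (?A + 2 * (- ?B / ?C) * ?B + (- ?B / ?C)\<^sup>2 * ?C)"
      using quad[of "- ?B / ?C"] C0 by simp
    also have "\<dots> = ?A * ?C - ?B\<^sup>2"
      using False by (simp add: power2_eq_square field_simps)
    finally show ?thesis by simp
  qed
qed

lemma nn_integral_square_finite_imp_sqint:
  assumes "f \<in> borel_measurable M" "(\<integral>\<^sup>+x. ennreal ((f x)\<^sup>2) \<partial>M) < \<infinity>"
  shows "sqint M f"
  using assms by (auto simp: sqint_def integrable_iff_bounded)

lemma sqint_nn_integral:
  "sqint M f \<Longrightarrow> (\<integral>\<^sup>+x. ennreal ((f x)\<^sup>2) \<partial>M) = ennreal (\<integral>x. (f x)\<^sup>2 \<partial>M)"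
  by (intro nn_integral_eq_integral) (auto simp: sqint_def)

text \<open>One approximation at distance below 1 is enough, since \<open>f\<close> is its sum with
  a square integrable error. The error is an \<open>nn_integral\<close> because a Bochner integral
  would be 0 by default where it diverges.\<close>

lemma sqint_limit:
  assumes f: "f \<in> borel_measurable M" and S: "\<And>k. sqint M (S k)"
    and lim: "(\<lambda>k. \<integral>\<^sup>+x. ennreal ((f x - S k x)\<^sup>2) \<partial>M) \<longlonglongrightarrow> 0"
  shows "sqint M f"
proof -
  have "\<forall>\<^sub>F k in sequentially. (\<integral>\<^sup>+x. ennreal ((f x - S k x)\<^sup>2) \<partial>M) < 1"
    using order_tendstoD(2)[OF lim, of 1] by simp
  then obtain k where k: "(\<integral>\<^sup>+x. ennreal ((f x - S k x)\<^sup>2) \<partial>M) < 1"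
    by (auto simp: eventually_sequentially)
  have "sqint M (\<lambda>x. f x - S k x)"
    by (rule nn_integral_square_finite_imp_sqint)
       (use f sqint_measurable[OF S[of k]] k in \<open>auto intro: less_trans\<close>)
  from sqint_add[OF this S[of k]] show ?thesis by simp
qed

text \<open>Cauchy-Schwarz controls the error by the L2 distance. The test function \<open>g\<close>
  will be a variable from the past, the constant 1, or the total increment of
  \<open>W\<close>.\<close>

lemma sqint_integral_mult_limit:
  assumes f: "f \<in> borel_measurable M" and S: "\<And>k. sqint M (S k)" and g: "sqint M g"
    and lim: "(\<lambda>k. \<integral>\<^sup>+x. ennreal ((f x - S k x)\<^sup>2) \<partial>M) \<longlonglongrightarrow> 0"
  shows "(\<lambda>k. \<integral>x. S k x * g x \<partial>M) \<longlonglongrightarrow> (\<integral>x. f x * g x \<partial>M)"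
proof -
  have fS: "sqint M f" by (rule sqint_limit[OF f S lim])
  have d: "sqint M (\<lambda>x. f x - S k x)" for k by (rule sqint_diff[OF fS S])
  let ?e = "\<lambda>k. \<integral>x. (f x - S k x)\<^sup>2 \<partial>M"
  have e0: "?e \<longlonglongrightarrow> 0"
  proof -
    have "(\<lambda>k. ennreal (?e k)) \<longlonglongrightarrow> ennreal 0"
      using lim by (simp add: sqint_nn_integral[OF d])
    then show ?thesis by (rule tendsto_ennrealD) auto
  qed
  have "(\<lambda>k. ((\<integral>x. f x * g x \<partial>M) - (\<integral>x. S k x * g x \<partial>M))\<^sup>2) \<longlonglongrightarrow> 0"
  proof (rule tendsto_sandwich[OF _ _ tendsto_const])
    show "(\<lambda>k. ?e k * (\<integral>x. (g x)\<^sup>2 \<partial>M)) \<longlonglongrightarrow> 0"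
      using tendsto_mult_left_zero[OF e0] by simp
    have "((\<integral>x. f x * g x \<partial>M) - (\<integral>x. S k x * g x \<partial>M)) = (\<integral>x. (f x - S k x) * g x \<partial>M)" for k
      using sqint_integrable_mult[OF fS g] sqint_integrable_mult[OF S g]
      by (simp add: left_diff_distrib)
    then show "\<forall>\<^sub>F k in sequentially. ((\<integral>x. f x * g x \<partial>M) - (\<integral>x. S k x * g x \<partial>M))\<^sup>2
        \<le> ?e k * (\<integral>x. (g x)\<^sup>2 \<partial>M)"
      using sqint_Cauchy_Schwarz[OF d g] by simp
  qed auto
  then have "(\<lambda>k. (\<integral>x. f x * g x \<partial>M) - (\<integral>x. S k x * g x \<partial>M)) \<longlonglongrightarrow> 0"
    using tendsto_real_sqrt[of "\<lambda>k. ((\<integral>x. f x * g x \<partial>M) - (\<integral>x. S k x * g x \<partial>M))\<^sup>2" 0]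
    by (simp add: tendsto_rabs_zero_iff)
  then show ?thesis
    using tendsto_diff[OF tendsto_const[of "\<integral>x. f x * g x \<partial>M"]] by fastforce
qed

lemma sqint_bounded_mult:
  assumes f: "f \<in> borel_measurable M" "\<And>x. x \<in> space M \<Longrightarrow> \<bar>f x\<bar> \<le> C" and g: "sqint M g"
  shows "sqint M (\<lambda>x. f x * g x)"
  unfolding sqint_def
proof
  show "(\<lambda>x. f x * g x) \<in> borel_measurable M"
    using f(1) sqint_measurable[OF g] by simp
  show "integrable M (\<lambda>x. (f x * g x)\<^sup>2)"
  proof (rule Bochner_Integration.integrable_bound)
    show "integrable M (\<lambda>x. C\<^sup>2 * (g x)\<^sup>2)"
      using sqint_integrable_square[OF g] by simp
    show "(\<lambda>x. (f x * g x)\<^sup>2) \<in> borel_measurable M"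
      using f(1) sqint_measurable[OF g] by simp
    show "AE x in M. norm ((f x * g x)\<^sup>2) \<le> norm (C\<^sup>2 * (g x)\<^sup>2)"
    proof (rule AE_I2)
      fix x assume "x \<in> space M"
      from power_mono[OF f(2)[OF this], of 2] have "(f x)\<^sup>2 \<le> C\<^sup>2" by simp
      then show "norm ((f x * g x)\<^sup>2) \<le> norm (C\<^sup>2 * (g x)\<^sup>2)"
        by (simp add: power_mult_distrib mult_right_mono)
    qed
  qed
qed


section \<open>Orthogonality of the increments of the Ito integral\<close>

locale wiener_setting = prob_space M for M :: "'w measure" +
  fixes F :: "real \<Rightarrow> 'w measure" and W :: "real \<Rightarrow> 'w \<Rightarrow> real" and T :: real
  assumes wiener: "wiener_process M F W" and T_pos: "0 < T"
begin

section \<open>Moments and independence of Wiener increments\<close>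

lemma subalg: "0 \<le> t \<Longrightarrow> subalgebra M (F t)"
  using wiener by (auto simp: wiener_process_def)

lemma measurable_F_imp_M: "0 \<le> t \<Longrightarrow> f \<in> borel_measurable (F t) \<Longrightarrow> f \<in> borel_measurable M"
  by (rule measurable_from_subalg[OF subalg])

lemma measurable_F_mono:
  assumes "0 \<le> s" "s \<le> t" "f \<in> borel_measurable (F s)"
  shows "f \<in> borel_measurable (F t)"
proof -
  have "filtration (space M) F" using wiener by (simp add: wiener_process_def)
  then have "subalgebra (F t) (F s)"
    using assms by (auto simp: subalgebra_def filtration_def)
  then show ?thesis using assms(3) by (rule measurable_from_subalg)
qed

lemma W_measurable_F: "0 \<le> t \<Longrightarrow> W t \<in> borel_measurable (F t)"
  using wiener by (auto simp: wiener_process_def)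

lemma W_measurable [measurable]: "0 \<le> t \<Longrightarrow> W t \<in> borel_measurable M"
  by (blast intro: measurable_F_imp_M W_measurable_F)

lemma W_increment_distributed:
  "0 \<le> s \<Longrightarrow> s < t \<Longrightarrow>
    distributed M lborel (\<lambda>\<omega>. W t \<omega> - W s \<omega>) (normal_density 0 (sqrt (t - s)))"
  using wiener by (auto simp: wiener_process_def)

lemma W_increment_moments:
  assumes "0 \<le> s" "s \<le> t"
  shows "sqint M (\<lambda>\<omega>. W t \<omega> - W s \<omega>)"
    and "expectation (\<lambda>\<omega>. W t \<omega> - W s \<omega>) = 0"
    and "expectation (\<lambda>\<omega>. (W t \<omega> - W s \<omega>)\<^sup>2) = t - s"
proof -
  have "sqint M (\<lambda>\<omega>. W t \<omega> - W s \<omega>) \<and> expectation (\<lambda>\<omega>. W t \<omega> - W s \<omega>) = 0 \<and>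
    expectation (\<lambda>\<omega>. (W t \<omega> - W s \<omega>)\<^sup>2) = t - s"
  \<comment> \<open>The increment over an empty interval has no normal density, so it is treated
    apart.\<close>
  proof (cases "s = t")
    case True
    then show ?thesis by (simp add: sqint_def)
  next
    case False
    then have st: "s < t" using assms by simp
    note D = W_increment_distributed[OF assms(1) st]
    have pos: "0 < sqrt (t - s)" using st by simp
    have [simp]: "0 \<le> t" using assms by simp
    have "integrable M (\<lambda>\<omega>. (W t \<omega> - W s \<omega>)\<^sup>2)"
      using distributed_integrable[OF D, of "\<lambda>x. x\<^sup>2"] integrable_normal_moment[OF pos, of 0 2]
      by simp
    moreover have "expectation (\<lambda>\<omega>. (W t \<omega> - W s \<omega>)\<^sup>2) = t - s"
      using distributed_integral[OF D, of "\<lambda>x. x\<^sup>2"] integral_normal_moment_even[OF pos, of 0 1] st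
      by simp
    moreover have "expectation (\<lambda>\<omega>. W t \<omega> - W s \<omega>) = 0"
      using distributed_integral[OF D, of "\<lambda>x. x"] integral_normal_moment_nz_1[OF pos, of 0]
      by simp
    ultimately show ?thesis using assms by (simp add: sqint_def)
  qed
  then show "sqint M (\<lambda>\<omega>. W t \<omega> - W s \<omega>)"
    and "expectation (\<lambda>\<omega>. W t \<omega> - W s \<omega>) = 0"
    and "expectation (\<lambda>\<omega>. (W t \<omega> - W s \<omega>)\<^sup>2) = t - s"
    by auto
qed

text \<open>Independence of two sigma-algebras passes to smaller ones. The function \<open>h\<close>
  will be the identity and the square, giving the first and second moments.\<close>

lemma W_increment_indep:
  assumes s: "0 \<le> s" "s < t" and \<xi>: "\<xi> \<in> borel_measurable (F s)" and h: "h \<in> borel_measurable borel"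
  shows "indep_var borel \<xi> borel (\<lambda>\<omega>. h (W t \<omega> - W s \<omega>))"
  unfolding indep_var_eq
proof (intro conjI)
  let ?D = "\<lambda>\<omega>. W t \<omega> - W s \<omega>"
  have [measurable]: "?D \<in> borel_measurable M" using s by simp
  show "random_variable borel \<xi>" using measurable_F_imp_M[OF s(1) \<xi>] .
  show "random_variable borel (\<lambda>\<omega>. h (?D \<omega>))"
    using measurable_compose[OF _ h, of ?D M] by simp
  have ind: "indep_set (sets (F s)) (sets (vimage_algebra (space M) ?D borel))"
    using wiener s by (auto simp: wiener_process_def)
  have sp: "space (F s) = space M" using subalg[OF s(1)] by (simp add: subalgebra_def)
  have 1: "sigma_sets (space M) {\<xi> -` A \<inter> space M |A. A \<in> sets borel} \<subseteq> sets (F s)"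
    unfolding sp[symmetric] by (rule sets.sigma_sets_subset) (use \<xi> in \<open>auto dest: measurable_sets\<close>)
  have hD: "(\<lambda>\<omega>. h (?D \<omega>)) \<in> borel_measurable (vimage_algebra (space M) ?D borel)"
    by (rule measurable_compose[OF measurable_vimage_algebra1 h]) auto
  have 2: "sigma_sets (space M) {(\<lambda>\<omega>. h (?D \<omega>)) -` A \<inter> space M |A. A \<in> sets borel}
      \<subseteq> sets (vimage_algebra (space M) ?D borel)"
    using sets.sigma_sets_subset[of "{(\<lambda>\<omega>. h (?D \<omega>)) -` A \<inter> space M |A. A \<in> sets borel}"
      "vimage_algebra (space M) ?D borel"] measurable_sets[OF hD]
    by auto
  show "indep_set (sigma_sets (space M) {\<xi> -` A \<inter> space M |A. A \<in> sets borel})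
     (sigma_sets (space M) {(\<lambda>\<omega>. h (?D \<omega>)) -` A \<inter> space M |A. A \<in> sets borel})"
    using ind unfolding indep_sets2_eq using 1 2 by blast
qed

text \<open>The first moment yields orthogonality to the past, the second the covariance of a simple
  integral with \<open>W\<close>. By independence, integrability of \<open>\<xi>\<close> alone makes
  the products integrable.\<close>

lemma expectation_mult_W_increment:
  assumes "0 \<le> s" "s \<le> t" "\<xi> \<in> borel_measurable (F s)" "integrable M \<xi>"
  shows "integrable M (\<lambda>\<omega>. \<xi> \<omega> * (W t \<omega> - W s \<omega>))"
    and "expectation (\<lambda>\<omega>. \<xi> \<omega> * (W t \<omega> - W s \<omega>)) = 0"
    and "integrable M (\<lambda>\<omega>. \<xi> \<omega> * (W t \<omega> - W s \<omega>)\<^sup>2)"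
    and "expectation (\<lambda>\<omega>. \<xi> \<omega> * (W t \<omega> - W s \<omega>)\<^sup>2) = expectation \<xi> * (t - s)"
proof -
  note mom = W_increment_moments[OF assms(1,2)]
  have "integrable M (\<lambda>\<omega>. \<xi> \<omega> * (W t \<omega> - W s \<omega>)) \<and>
    expectation (\<lambda>\<omega>. \<xi> \<omega> * (W t \<omega> - W s \<omega>)) = 0 \<and>
    integrable M (\<lambda>\<omega>. \<xi> \<omega> * (W t \<omega> - W s \<omega>)\<^sup>2) \<and>
    expectation (\<lambda>\<omega>. \<xi> \<omega> * (W t \<omega> - W s \<omega>)\<^sup>2) = expectation \<xi> * (t - s)"
  proof (cases "s = t")
    case False
    then have st: "s < t" using assms by simp
    have i1: "indep_var borel \<xi> borel (\<lambda>\<omega>. W t \<omega> - W s \<omega>)"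
      using W_increment_indep[OF assms(1) st assms(3), of "\<lambda>x. x"] by simp
    have i2: "indep_var borel \<xi> borel (\<lambda>\<omega>. (W t \<omega> - W s \<omega>)\<^sup>2)"
      using W_increment_indep[OF assms(1) st assms(3), of "\<lambda>x. x\<^sup>2"] by simp
    note int = sqint_integrable[OF mom(1)] sqint_integrable_square[OF mom(1)]
    show ?thesis
      using indep_var_integrable[OF i1 assms(4) int(1)] indep_var_integrable[OF i2 assms(4) int(2)]
        indep_var_lebesgue_integral[OF i1 assms(4) int(1)]
        indep_var_lebesgue_integral[OF i2 assms(4) int(2)] mom
      by simp
  qed simp
  then show "integrable M (\<lambda>\<omega>. \<xi> \<omega> * (W t \<omega> - W s \<omega>))"
    and "expectation (\<lambda>\<omega>. \<xi> \<omega> * (W t \<omega> - W s \<omega>)) = 0"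
    and "integrable M (\<lambda>\<omega>. \<xi> \<omega> * (W t \<omega> - W s \<omega>)\<^sup>2)"
    and "expectation (\<lambda>\<omega>. \<xi> \<omega> * (W t \<omega> - W s \<omega>)\<^sup>2) = expectation \<xi> * (t - s)"
    by auto
qed

section \<open>Processes with increments orthogonal to the past\<close>

lemma simple_data_bounds:
  assumes "simple_data M F T n \<tau> \<xi>" "i < n"
  shows "0 \<le> \<tau> i" "\<tau> i < \<tau> (Suc i)" "\<tau> (Suc i) \<le> T"
proof -
  have mono: "strict_mono_on {0..n} \<tau>" and "\<tau> 0 = 0" "\<tau> n = T"
    using assms by (auto simp: simple_data_def)
  moreover have "mono_on {0..n} \<tau>" using mono by (rule strict_mono_on_imp_mono_on)
  ultimately show "0 \<le> \<tau> i" "\<tau> (Suc i) \<le> T"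
    using assms(2) mono_onD[of "{0..n}" \<tau> 0 i] mono_onD[of "{0..n}" \<tau> "Suc i" n] by auto
  show "\<tau> i < \<tau> (Suc i)"
    using assms(2) strict_mono_onD[OF mono, of i "Suc i"] by auto
qed

text \<open>The square integrable martingale property in weak form, without adaptedness of
  \<open>N\<close>: the conditional expectation of \<open>N t - N s\<close> given \<open>F s\<close>
  is zero, expressed by test variables. It is insensitive to changes of \<open>N t\<close> on null
  sets that keep it measurable.\<close>

definition orthogonal_increments :: "(real \<Rightarrow> 'w \<Rightarrow> real) \<Rightarrow> bool" where
  "orthogonal_increments N \<longleftrightarrow>
     (\<forall>t\<in>{0..T}. sqint M (N t)) \<and>
     (\<forall>s t \<zeta>. 0 \<le> s \<and> s \<le> t \<and> t \<le> T \<and> \<zeta> \<in> borel_measurable (F s) \<and> sqint M \<zeta> \<longrightarrow>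
        expectation (\<lambda>\<omega>. (N t \<omega> - N s \<omega>) * \<zeta> \<omega>) = 0)"

lemma orthogonal_increments_lincomb:
  assumes "orthogonal_increments N" "orthogonal_increments N'"
  shows "orthogonal_increments (\<lambda>t \<omega>. \<alpha> * N t \<omega> + \<beta> * N' t \<omega>)"
  unfolding orthogonal_increments_def
proof (intro conjI ballI allI impI)
  fix t assume "t \<in> {0..T}"
  then show "sqint M (\<lambda>\<omega>. \<alpha> * N t \<omega> + \<beta> * N' t \<omega>)"
    using assms by (auto simp: orthogonal_increments_def intro!: sqint_add sqint_cmult)
next
  fix s t \<zeta>
  assume a: "0 \<le> s \<and> s \<le> t \<and> t \<le> T \<and> \<zeta> \<in> borel_measurable (F s) \<and> sqint M \<zeta>"
  then have "sqint M (\<lambda>\<omega>. N t \<omega> - N s \<omega>)" "sqint M (\<lambda>\<omega>. N' t \<omega> - N' s \<omega>)"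
    using assms by (auto simp: orthogonal_increments_def intro!: sqint_diff)
  then have int: "integrable M (\<lambda>\<omega>. (N t \<omega> - N s \<omega>) * \<zeta> \<omega>)"
    "integrable M (\<lambda>\<omega>. (N' t \<omega> - N' s \<omega>) * \<zeta> \<omega>)"
    using a by (auto intro: sqint_integrable_mult)
  have "expectation (\<lambda>\<omega>. (\<alpha> * N t \<omega> + \<beta> * N' t \<omega> - (\<alpha> * N s \<omega> + \<beta> * N' s \<omega>)) * \<zeta> \<omega>)
    = expectation (\<lambda>\<omega>. \<alpha> * ((N t \<omega> - N s \<omega>) * \<zeta> \<omega>) + \<beta> * ((N' t \<omega> - N' s \<omega>) * \<zeta> \<omega>))"
    by (simp add: algebra_simps)
  also have "\<dots> = \<alpha> * expectation (\<lambda>\<omega>. (N t \<omega> - N s \<omega>) * \<zeta> \<omega>)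
      + \<beta> * expectation (\<lambda>\<omega>. (N' t \<omega> - N' s \<omega>) * \<zeta> \<omega>)"
    using int by simp
  also have "\<dots> = 0"
    using a assms by (simp add: orthogonal_increments_def)
  finally show "expectation (\<lambda>\<omega>. (\<alpha> * N t \<omega> + \<beta> * N' t \<omega> - (\<alpha> * N s \<omega> + \<beta> * N' s \<omega>)) * \<zeta> \<omega>) = 0" .
qed

lemma orthogonal_increments_simple_integral:
  assumes sd: "simple_data M F T n \<tau> \<xi>"
  shows "orthogonal_increments (simple_integral W n \<tau> \<xi>)"
proof -
  obtain C where C: "\<And>i \<omega>. i < n \<Longrightarrow> \<omega> \<in> space M \<Longrightarrow> \<bar>\<xi> i \<omega>\<bar> \<le> C"
    using sd by (auto simp: simple_data_def)
  have \<xi>F: "\<xi> i \<in> borel_measurable (F (\<tau> i))" if "i < n" for i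
    using sd that by (auto simp: simple_data_def)
  note \<tau> = simple_data_bounds[OF sd]
  have \<xi>M: "\<xi> i \<in> borel_measurable M" if "i < n" for i
    using measurable_F_imp_M[OF \<tau>(1) \<xi>F] that by blast
  let ?J = "\<lambda>t i \<omega>. \<xi> i \<omega> * (W (min t (\<tau> (Suc i))) \<omega> - W (min t (\<tau> i)) \<omega>)"
  have J: "sqint M (?J t i)" if "0 \<le> t" "i < n" for t i
  proof (rule sqint_bounded_mult[OF \<xi>M C W_increment_moments(1)])
    show "0 \<le> min t (\<tau> i)" "min t (\<tau> i) \<le> min t (\<tau> (Suc i))"
      using \<tau>[OF that(2)] that by auto
  qed (use that in auto)
  have sum: "simple_integral W n \<tau> \<xi> t = (\<lambda>\<omega>. \<Sum>i<n. ?J t i \<omega>)" for t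
    by (simp add: simple_integral_def fun_eq_iff)
  show ?thesis
    unfolding orthogonal_increments_def
  proof (intro conjI ballI allI impI)
    show "sqint M (simple_integral W n \<tau> \<xi> t)" if "t \<in> {0..T}" for t
      unfolding sum using that by (auto intro!: sqint_sum J)
  next
    fix s t \<zeta>
    assume a: "0 \<le> s \<and> s \<le> t \<and> t \<le> T \<and> \<zeta> \<in> borel_measurable (F s) \<and> sqint M \<zeta>"
    have zero: "expectation (\<lambda>\<omega>. (?J t i \<omega> - ?J s i \<omega>) * \<zeta> \<omega>) = 0" if i: "i < n" for i
    proof -
      \<comment> \<open>The part of the \<open>i\<close>-th interval lying between \<open>s\<close>
        and \<open>t\<close> runs from \<open>p\<close> to \<open>v\<close>; the outer
        \<open>max\<close> shrinks it to a point when it is empty. Since \<open>p\<close> is past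
        both \<open>s\<close> and \<open>\<tau> i\<close>, both \<open>\<zeta>\<close> and
        \<open>\<xi> i\<close> are known at \<open>p\<close>, so the increment from \<open>p\<close>
        to \<open>v\<close> is centred against their product.\<close>
      define p where "p = max s (\<tau> i)"
      define v where "v = max p (min t (\<tau> (Suc i)))"
      have p: "0 \<le> p" "s \<le> p" "\<tau> i \<le> p" "p \<le> v"
        using a \<tau>[OF i] by (auto simp: p_def v_def)
      have "?J t i \<omega> - ?J s i \<omega> = \<xi> i \<omega> * (W v \<omega> - W p \<omega>)" for \<omega>
      proof -
        have "W (min t (\<tau> (Suc i))) \<omega> - W (min t (\<tau> i)) \<omega>
            - (W (min s (\<tau> (Suc i))) \<omega> - W (min s (\<tau> i)) \<omega>) = W v \<omega> - W p \<omega>"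
          using a \<tau>[OF i] unfolding p_def v_def max_def min_def by auto
        then show ?thesis by (simp flip: right_diff_distrib)
      qed
      then have "(\<lambda>\<omega>. (?J t i \<omega> - ?J s i \<omega>) * \<zeta> \<omega>) = (\<lambda>\<omega>. (\<xi> i \<omega> * \<zeta> \<omega>) * (W v \<omega> - W p \<omega>))"
        by (simp add: ac_simps)
      moreover have "(\<lambda>\<omega>. \<xi> i \<omega> * \<zeta> \<omega>) \<in> borel_measurable (F p)"
        using measurable_F_mono[OF _ p(3) \<xi>F] measurable_F_mono[OF _ p(2), of \<zeta>] a i \<tau>[OF i]
        by (intro borel_measurable_times) auto
      moreover have "integrable M (\<lambda>\<omega>. \<xi> i \<omega> * \<zeta> \<omega>)"
        using a i C \<xi>M by (intro sqint_integrable sqint_bounded_mult[where C=C]) auto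
      ultimately show ?thesis
        using expectation_mult_W_increment(2)[OF p(1) p(4)] by simp
    qed
    have int: "integrable M (\<lambda>\<omega>. (?J t i \<omega> - ?J s i \<omega>) * \<zeta> \<omega>)" if "i < n" for i
      using a that by (intro sqint_integrable_mult sqint_diff J) auto
    have "expectation (\<lambda>\<omega>. (simple_integral W n \<tau> \<xi> t \<omega> - simple_integral W n \<tau> \<xi> s \<omega>) * \<zeta> \<omega>)
        = expectation (\<lambda>\<omega>. \<Sum>i<n. (?J t i \<omega> - ?J s i \<omega>) * \<zeta> \<omega>)"
      unfolding sum by (simp only: sum_subtractf[symmetric] sum_distrib_right[symmetric])
    also have "\<dots> = 0"
      using int zero by (subst Bochner_Integration.integral_sum) auto
    finally show "expectation (\<lambda>\<omega>. (simple_integral W n \<tau> \<xi> t \<omega> - simple_integral W n \<tau> \<xi> s \<omega>) * \<zeta> \<omega>) = 0" .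
  qed
qed

text \<open>Orthogonality is a relation between inner products with \<open>\<zeta>\<close> at two
  fixed times, so it passes to the L2 limit.\<close>

lemma orthogonal_increments_ito_integral:
  assumes "has_ito_integral M F W T H I"
  shows "orthogonal_increments I"
proof -
  obtain n \<tau> \<xi> where sd: "\<And>k. simple_data M F T (n k) (\<tau> k) (\<xi> k)"
    and lim: "\<And>t. t \<in> {0..T} \<Longrightarrow>
      (\<lambda>k. \<integral>\<^sup>+\<omega>. ennreal ((I t \<omega> - simple_integral W (n k) (\<tau> k) (\<xi> k) t \<omega>)\<^sup>2) \<partial>M) \<longlonglongrightarrow> 0"
    and meas: "\<And>t. t \<in> {0..T} \<Longrightarrow> I t \<in> borel_measurable M"
    using assms unfolding has_ito_integral_def by blast
  let ?S = "\<lambda>k. simple_integral W (n k) (\<tau> k) (\<xi> k)"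
  note S = orthogonal_increments_simple_integral[OF sd]
  have S1: "sqint M (?S k t)" if "t \<in> {0..T}" for k t
    using S[of k] that by (auto simp: orthogonal_increments_def)
  show ?thesis
    unfolding orthogonal_increments_def
  proof (intro conjI ballI allI impI)
    show I: "sqint M (I t)" if "t \<in> {0..T}" for t
      using sqint_limit[OF meas S1 lim] that by blast
    fix s t \<zeta>
    assume a: "0 \<le> s \<and> s \<le> t \<and> t \<le> T \<and> \<zeta> \<in> borel_measurable (F s) \<and> sqint M \<zeta>"
    then have st: "s \<in> {0..T}" "t \<in> {0..T}" and \<zeta>: "sqint M \<zeta>" by auto
    have "(\<lambda>k. expectation (\<lambda>\<omega>. ?S k t \<omega> * \<zeta> \<omega>) - expectation (\<lambda>\<omega>. ?S k s \<omega> * \<zeta> \<omega>))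
      \<longlonglongrightarrow> expectation (\<lambda>\<omega>. I t \<omega> * \<zeta> \<omega>) - expectation (\<lambda>\<omega>. I s \<omega> * \<zeta> \<omega>)"
      by (intro tendsto_diff sqint_integral_mult_limit meas S1 lim \<zeta> st)
    moreover have "expectation (\<lambda>\<omega>. ?S k t \<omega> * \<zeta> \<omega>) - expectation (\<lambda>\<omega>. ?S k s \<omega> * \<zeta> \<omega>) = 0" for k
    proof -
      have "expectation (\<lambda>\<omega>. (?S k t \<omega> - ?S k s \<omega>) * \<zeta> \<omega>) = 0"
        using S[of k] a unfolding orthogonal_increments_def by blast
      then show ?thesis
        using sqint_integrable_mult[OF S1[OF st(1)] \<zeta>] sqint_integrable_mult[OF S1[OF st(2)] \<zeta>]
        by (simp add: left_diff_distrib)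
    qed
    ultimately have "expectation (\<lambda>\<omega>. I t \<omega> * \<zeta> \<omega>) - expectation (\<lambda>\<omega>. I s \<omega> * \<zeta> \<omega>) = 0"
      by (simp add: LIMSEQ_const_iff)
    then show "expectation (\<lambda>\<omega>. (I t \<omega> - I s \<omega>) * \<zeta> \<omega>) = 0"
      using sqint_integrable_mult[OF I[OF st(1)] \<zeta>] sqint_integrable_mult[OF I[OF st(2)] \<zeta>]
      by (simp add: left_diff_distrib)
  qed
qed

section \<open>The Ito integral of a nonzero constant does not vanish\<close>

text \<open>The polarised Ito isometry, for a simple integrand and the constant integrand 1.
  \<open>W 0\<close> is subtracted because it is zero only almost surely.\<close>

lemma expectation_simple_integral_mult_W:
  assumes sd: "simple_data M F T n \<tau> \<xi>"
  shows "expectation (\<lambda>\<omega>. simple_integral W n \<tau> \<xi> T \<omega> * (W T \<omega> - W 0 \<omega>))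
    = expectation (\<lambda>\<omega>. \<Sum>i<n. \<xi> i \<omega> * (\<tau> (Suc i) - \<tau> i))"
proof -
  obtain C where C: "\<And>i \<omega>. i < n \<Longrightarrow> \<omega> \<in> space M \<Longrightarrow> \<bar>\<xi> i \<omega>\<bar> \<le> C"
    using sd by (auto simp: simple_data_def)
  have \<xi>F: "\<xi> i \<in> borel_measurable (F (\<tau> i))" if "i < n" for i
    using sd that by (auto simp: simple_data_def)
  note \<tau> = simple_data_bounds[OF sd]
  have \<xi>M: "\<xi> i \<in> borel_measurable M" if "i < n" for i
    using measurable_F_imp_M[OF \<tau>(1) \<xi>F] that by blast
  have \<xi>int: "integrable M (\<xi> i)" if "i < n" for i
    by (rule integrable_const_bound[of _ C]) (use C \<xi>M that in auto)
  let ?J = "\<lambda>i \<omega>. \<xi> i \<omega> * (W (\<tau> (Suc i)) \<omega> - W (\<tau> i) \<omega>)"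
  have step: "integrable M (\<lambda>\<omega>. ?J i \<omega> * (W T \<omega> - W 0 \<omega>)) \<and>
      expectation (\<lambda>\<omega>. ?J i \<omega> * (W T \<omega> - W 0 \<omega>)) = expectation (\<xi> i) * (\<tau> (Suc i) - \<tau> i)"
    if i: "i < n" for i
  proof -
    let ?u = "\<tau> i" and ?v = "\<tau> (Suc i)"
    note b = \<tau>[OF i]
    have v: "0 \<le> ?v" "?u \<le> ?v" using b by auto
    have JF: "?J i \<in> borel_measurable (F ?v)"
      using measurable_F_mono[OF b(1) v(2) \<xi>F[OF i]] W_measurable_F[OF v(1)]
        measurable_F_mono[OF b(1) v(2) W_measurable_F[OF b(1)]]
      by (intro borel_measurable_times borel_measurable_diff)
    have J: "integrable M (?J i)"
      by (rule expectation_mult_W_increment(1)[OF b(1) v(2) \<xi>F[OF i] \<xi>int[OF i]])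
    have KF: "(\<lambda>\<omega>. \<xi> i \<omega> * (W ?u \<omega> - W 0 \<omega>)) \<in> borel_measurable (F ?u)"
      using \<xi>F[OF i] W_measurable_F[OF b(1)] measurable_F_mono[OF order_refl b(1) W_measurable_F[OF order_refl]]
      by (intro borel_measurable_times borel_measurable_diff)
    have K: "integrable M (\<lambda>\<omega>. \<xi> i \<omega> * (W ?u \<omega> - W 0 \<omega>))"
      using C \<xi>M i b(1)
      by (intro sqint_integrable sqint_bounded_mult[where C=C] W_increment_moments(1)) auto
    note e1 = expectation_mult_W_increment(1,2)[OF v(1) b(3) JF J]
    note e2 = expectation_mult_W_increment(3,4)[OF b(1) v(2) \<xi>F[OF i] \<xi>int[OF i]]
    note e3 = expectation_mult_W_increment(1,2)[OF b(1) v(2) KF K]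
    \<comment> \<open>\<open>W T - W 0\<close> is split at the ends of the \<open>i\<close>-th
      interval. The later piece is independent of the past, and in the earlier piece the factor
      \<open>W ?v - W ?u\<close> is; only the square in the middle has nonzero mean.\<close>
    have "(\<lambda>\<omega>. ?J i \<omega> * (W T \<omega> - W 0 \<omega>)) =
      (\<lambda>\<omega>. ?J i \<omega> * (W T \<omega> - W ?v \<omega>) + \<xi> i \<omega> * (W ?v \<omega> - W ?u \<omega>)\<^sup>2
        + \<xi> i \<omega> * (W ?u \<omega> - W 0 \<omega>) * (W ?v \<omega> - W ?u \<omega>))"
      by (simp add: fun_eq_iff algebra_simps power2_eq_square)
    then show ?thesis using e1 e2 e3 by simp
  qed
  have "expectation (\<lambda>\<omega>. simple_integral W n \<tau> \<xi> T \<omega> * (W T \<omega> - W 0 \<omega>))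
      = expectation (\<lambda>\<omega>. \<Sum>i<n. ?J i \<omega> * (W T \<omega> - W 0 \<omega>))"
  proof -
    have "simple_integral W n \<tau> \<xi> T \<omega> = (\<Sum>i<n. ?J i \<omega>)" for \<omega>
      unfolding simple_integral_def using \<tau>
      by (intro sum.cong refl) (smt (verit) lessThan_iff min.absorb2)
    then show ?thesis by (simp add: sum_distrib_right)
  qed
  also have "\<dots> = (\<Sum>i<n. expectation (\<xi> i) * (\<tau> (Suc i) - \<tau> i))"
    using step by (subst Bochner_Integration.integral_sum) auto
  also have "\<dots> = expectation (\<lambda>\<omega>. \<Sum>i<n. \<xi> i \<omega> * (\<tau> (Suc i) - \<tau> i))"
    using \<xi>int by (subst Bochner_Integration.integral_sum) auto
  finally show ?thesis .
qed

text \<open>Cauchy-Schwarz in time against the constant 1 on \<open>{0..T}\<close>, for each fixed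
  path. It turns the L2 convergence of the integrands into L2 convergence of their time
  integrals.\<close>

lemma simple_process_time_integral_bound:
  assumes sd: "simple_data M F T n \<tau> \<xi>"
  shows "ennreal ((D * T - (\<Sum>i<n. \<xi> i \<omega> * (\<tau> (Suc i) - \<tau> i)))\<^sup>2)
    \<le> ennreal T * (\<integral>\<^sup>+t\<in>{0..T}. ennreal ((D - simple_process n \<tau> \<xi> t \<omega>)\<^sup>2) \<partial>lborel)"
proof -
  note \<tau> = simple_data_bounds[OF sd]
  have sq: "(\<lambda>t. (indicator A t :: real)\<^sup>2) = indicator A" for A :: "real set"
    by (auto simp: indicator_def)
  have ind: "sqint lborel (indicator {0..T})"
    by (simp add: sqint_def sq integrable_indicator_iff emeasure_lborel_Icc_eq)
  have ind': "sqint lborel (indicator {\<tau> i<..\<tau> (Suc i)})" if "i < n" for i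
    using \<tau>[OF that] by (simp add: sqint_def sq integrable_indicator_iff)
  let ?f = "\<lambda>t. D * indicator {0..T} t - (\<Sum>i<n. \<xi> i \<omega> * indicator {\<tau> i<..\<tau> (Suc i)} t) :: real"
  have f: "sqint lborel ?f"
    by (intro sqint_diff sqint_cmult sqint_sum ind ind') auto
  have f_eq: "?f t = (D - simple_process n \<tau> \<xi> t \<omega>) * indicator {0..T} t" for t
  proof (cases "t \<in> {0..T}")
    case False
    then have "indicator {\<tau> i<..\<tau> (Suc i)} t = (0 :: real)" if "i < n" for i
      using \<tau>[OF that] by (auto simp: indicator_def)
    then show ?thesis using False by simp
  qed (simp add: simple_process_def)
  have "(\<integral>t. ?f t * indicator {0..T} t \<partial>lborel) = (\<integral>t. ?f t \<partial>lborel)"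
    unfolding f_eq by (intro Bochner_Integration.integral_cong refl) (simp split: split_indicator)
  also have "\<dots> = D * T - (\<Sum>i<n. \<xi> i \<omega> * (\<tau> (Suc i) - \<tau> i))"
  proof -
    have int1: "integrable lborel (\<lambda>t. D * indicator {0..T} t :: real)"
      by (simp add: emeasure_lborel_Icc_eq)
    have int2: "integrable lborel (\<lambda>t. \<xi> i \<omega> * indicator {\<tau> i<..\<tau> (Suc i)} t :: real)" if "i < n" for i
      using \<tau>[OF that] by simp
    have "(\<integral>t. ?f t \<partial>lborel) = (\<integral>t. D * indicator {0..T} t \<partial>lborel)
        - (\<integral>t. (\<Sum>i<n. \<xi> i \<omega> * indicator {\<tau> i<..\<tau> (Suc i)} t) \<partial>lborel)"
      using int2 by (intro Bochner_Integration.integral_diff int1 Bochner_Integration.integrable_sum) auto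
    also have "(\<integral>t. (\<Sum>i<n. \<xi> i \<omega> * indicator {\<tau> i<..\<tau> (Suc i)} t) \<partial>lborel)
        = (\<Sum>i<n. \<integral>t. \<xi> i \<omega> * indicator {\<tau> i<..\<tau> (Suc i)} t \<partial>lborel)"
      using int2 by (intro Bochner_Integration.integral_sum) auto
    also have "\<dots> = (\<Sum>i<n. \<xi> i \<omega> * (\<tau> (Suc i) - \<tau> i))"
      using \<tau> by (intro sum.cong refl) (simp add: less_imp_le)
    finally show ?thesis using T_pos by simp
  qed
  finally have eq: "(\<integral>t. ?f t * indicator {0..T} t \<partial>lborel) = D * T - (\<Sum>i<n. \<xi> i \<omega> * (\<tau> (Suc i) - \<tau> i))" .
  have indsq: "(\<integral>t. (indicator {0..T} t :: real)\<^sup>2 \<partial>lborel) = T"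
    using T_pos by (simp add: sq)
  have "ennreal ((D * T - (\<Sum>i<n. \<xi> i \<omega> * (\<tau> (Suc i) - \<tau> i)))\<^sup>2) \<le> ennreal (T * (\<integral>t. (?f t)\<^sup>2 \<partial>lborel))"
    using sqint_Cauchy_Schwarz[OF f ind] unfolding eq indsq by (intro ennreal_leI) (simp add: mult.commute)
  also have "\<dots> = ennreal T * (\<integral>\<^sup>+t. ennreal ((?f t)\<^sup>2) \<partial>lborel)"
    unfolding sqint_nn_integral[OF f] using T_pos
    by (intro ennreal_mult Bochner_Integration.integral_nonneg) auto
  also have "(\<integral>\<^sup>+t. ennreal ((?f t)\<^sup>2) \<partial>lborel) =
      (\<integral>\<^sup>+t\<in>{0..T}. ennreal ((D - simple_process n \<tau> \<xi> t \<omega>)\<^sup>2) \<partial>lborel)"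
    unfolding f_eq by (intro nn_integral_cong) (simp add: indicator_def)
  finally show ?thesis .
qed

text \<open>Test against the total increment of \<open>W\<close>: the covariance of \<open>\<integral> D dW\<close> with it is \<open>D T\<close>.\<close>

lemma ito_integral_const_zero_imp:
  assumes ito: "has_ito_integral M F W T (\<lambda>t \<omega>. D) I" and zero: "AE \<omega> in M. I T \<omega> = 0"
  shows "D = 0"
proof -
  obtain n \<tau> \<xi> where sd: "\<And>k. simple_data M F T (n k) (\<tau> k) (\<xi> k)"
    and L2: "(\<lambda>k. L2_dist M T (\<lambda>t \<omega>. D) (simple_process (n k) (\<tau> k) (\<xi> k))) \<longlonglongrightarrow> 0"
    and lim: "(\<lambda>k. \<integral>\<^sup>+\<omega>. ennreal ((I T \<omega> - simple_integral W (n k) (\<tau> k) (\<xi> k) T \<omega>)\<^sup>2) \<partial>M) \<longlonglongrightarrow> 0"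
    and meas: "I T \<in> borel_measurable M"
    using ito T_pos unfolding has_ito_integral_def by fastforce
  let ?R = "\<lambda>k \<omega>. \<Sum>i<n k. \<xi> k i \<omega> * (\<tau> k (Suc i) - \<tau> k i)"
  have "sqint M (\<xi> k i)" if i: "i < n k" for k i
  proof -
    obtain C where C: "\<And>\<omega>. \<omega> \<in> space M \<Longrightarrow> \<bar>\<xi> k i \<omega>\<bar> \<le> C"
      using sd[of k] i by (auto simp: simple_data_def)
    have "\<xi> k i \<in> borel_measurable M"
      using measurable_F_imp_M[OF simple_data_bounds(1)[OF sd i]] sd[of k] i
      by (auto simp: simple_data_def)
    from sqint_bounded_mult[OF this C, of "\<lambda>_. 1"] show ?thesis
      by (simp add: sqint_def[of M "\<lambda>_. 1"])
  qed
  then have R: "sqint M (?R k)" for k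
    using sqint_cmult[of M "\<xi> k i" "\<tau> k (Suc i) - \<tau> k i" for i]
    by (intro sqint_sum) (auto simp: mult.commute)
  have "(\<lambda>k. \<integral>\<^sup>+\<omega>. ennreal ((D * T - ?R k \<omega>)\<^sup>2) \<partial>M) \<longlonglongrightarrow> 0"
  proof (rule tendsto_sandwich[OF _ _ tendsto_const])
    show "(\<lambda>k. ennreal T * L2_dist M T (\<lambda>t \<omega>. D) (simple_process (n k) (\<tau> k) (\<xi> k))) \<longlonglongrightarrow> 0"
      using ennreal_tendsto_cmult[OF _ L2, of "ennreal T"] by simp
    show "\<forall>\<^sub>F k in sequentially. (\<integral>\<^sup>+\<omega>. ennreal ((D * T - ?R k \<omega>)\<^sup>2) \<partial>M)
      \<le> ennreal T * L2_dist M T (\<lambda>t \<omega>. D) (simple_process (n k) (\<tau> k) (\<xi> k))"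
    proof (rule always_eventually, rule allI)
      fix k
      have m: "(\<lambda>\<omega>. \<integral>\<^sup>+t\<in>{0..T}. ennreal ((D - simple_process (n k) (\<tau> k) (\<xi> k) t \<omega>)\<^sup>2) \<partial>lborel)
          \<in> borel_measurable M"
      proof -
        have [measurable]: "\<xi> k i \<in> borel_measurable M" if "i \<in> {..<n k}" for i
          using measurable_F_imp_M[OF simple_data_bounds(1)[OF sd]] sd[of k] that
          by (auto simp: simple_data_def)
        show ?thesis unfolding simple_process_def by measurable
      qed
      show "(\<integral>\<^sup>+\<omega>. ennreal ((D * T - ?R k \<omega>)\<^sup>2) \<partial>M)
        \<le> ennreal T * L2_dist M T (\<lambda>t \<omega>. D) (simple_process (n k) (\<tau> k) (\<xi> k))"
        unfolding L2_dist_def nn_integral_cmult[OF m, symmetric]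
        by (intro nn_integral_mono simple_process_time_integral_bound[OF sd])
    qed
  qed auto
  from sqint_integral_mult_limit[OF _ R _ this, of "\<lambda>_. 1"]
  have "(\<lambda>k. expectation (?R k)) \<longlonglongrightarrow> D * T"
    by (simp add: sqint_def[of M "\<lambda>_. 1"] prob_space)
  \<comment> \<open>The same expectations are also the covariances of the simple integrals with
    \<open>W T - W 0\<close>, which converge to that of \<open>I T\<close>; the two limits must
    agree.\<close>
  moreover have "(\<lambda>k. expectation (?R k)) \<longlonglongrightarrow> expectation (\<lambda>\<omega>. I T \<omega> * (W T \<omega> - W 0 \<omega>))"
    unfolding expectation_simple_integral_mult_W[OF sd, symmetric]
    using orthogonal_increments_simple_integral[OF sd] T_pos
    by (intro sqint_integral_mult_limit[OF meas _ _ lim] W_increment_moments(1))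
       (auto simp: orthogonal_increments_def)
  moreover have "expectation (\<lambda>\<omega>. I T \<omega> * (W T \<omega> - W 0 \<omega>)) = 0"
    by (rule integral_eq_zero_AE) (use zero in auto)
  ultimately have "D * T = 0"
    using LIMSEQ_unique by fastforce
  then show ?thesis using T_pos by simp
qed

end


section \<open>Time integrals with orthogonal increments\<close>

text \<open>Differentiate the integral. The derivative is taken within \<open>{0..T}\<close>, so the
  end points are included; it is unique there because \<open>0 < T\<close>.\<close>

lemma continuous_integral_zero_imp_zero:
  fixes f :: "real \<Rightarrow> real"
  assumes T: "0 < T" and f: "continuous_on {0..T} f"
    and zero: "\<And>t. t \<in> {0..T} \<Longrightarrow> (LBINT s:{0..t}. f s) = 0" and t: "t \<in> {0..T}"
  shows "f t = 0"
proof -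
  have int: "integral {0..u} f = 0" if "u \<in> {0..T}" for u
  proof -
    have "continuous_on {0..u} f" using f by (rule continuous_on_subset) (use that in auto)
    then have "set_integrable lborel {0..u} f" by (rule borel_integrable_atLeastAtMost')
    from set_borel_integral_eq_integral(2)[OF this] show ?thesis using zero[OF that] by simp
  qed
  have "((\<lambda>u. integral {0..u} f) has_vector_derivative f t) (at t within {0..T})"
    by (rule integral_has_vector_derivative[OF f t])
  then have "((\<lambda>u. 0) has_vector_derivative f t) (at t within {0..T})"
    by (rule has_vector_derivative_transform[OF t, rotated]) (simp add: int)
  then show "f t = 0"
    using vector_derivative_unique_within_closed_interval[of 0 T t "\<lambda>_. 0" "f t" 0]
      has_vector_derivative_const[of "0 :: real"] T t
    unfolding cbox_interval by blast
qed

lemma continuous_on_set_integral: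
  fixes f :: "real \<Rightarrow> real"
  assumes "set_integrable lborel {0..T} f"
  shows "continuous_on {0..T} (\<lambda>t. LBINT s:{0..t}. f s)"
proof -
  have "(LBINT s:{0..t}. f s) = integral {0..t} f" if "t \<in> {0..T}" for t
    by (rule set_borel_integral_eq_integral(2), rule set_integrable_subset[OF assms]) (use that in auto)
  moreover have "continuous_on {0..T} (\<lambda>t. integral {0..t} f)"
    by (intro indefinite_integral_continuous_1 set_borel_integral_eq_integral(1) assms)
  ultimately show ?thesis by (metis (no_types, lifting) continuous_on_eq)
qed

context wiener_setting
begin

text \<open>The exceptional null set depends on \<open>t\<close>. Over rational times the union of
  these sets is still null, and continuity extends the identity to the closure, which contains the
  end points.\<close>

lemma AE_continuous_zero:
  fixes g :: "real \<Rightarrow> 'w \<Rightarrow> real"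
  assumes cont: "AE \<omega> in M. continuous_on {0..T} (\<lambda>t. g t \<omega>)"
    and zero: "\<And>t. t \<in> {0..T} \<Longrightarrow> AE \<omega> in M. g t \<omega> = 0"
  shows "AE \<omega> in M. \<forall>t\<in>{0..T}. g t \<omega> = 0"
proof -
  have "AE \<omega> in M. \<forall>t\<in>{0<..<T} \<inter> \<rat>. g t \<omega> = 0"
    by (rule AE_ball_countable') (use zero in \<open>auto intro: countable_Int2 countable_rat\<close>)
  with cont show ?thesis
  proof eventually_elim
    case (elim \<omega>)
    have cl: "closure ({0<..<T} \<inter> \<rat>) = {0..T}"
      using T_pos by (subst closure_open_Int_superset) (auto simp: Rats_closure_real)
    have "closed {t \<in> {0..T}. g t \<omega> = 0}"
      by (rule continuous_closed_preimage_constant[OF elim(1)]) simp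
    moreover have "{0<..<T} \<inter> \<rat> \<subseteq> {t \<in> {0..T}. g t \<omega> = 0}"
      using elim(2) by auto
    ultimately show ?case
      using closure_minimal[of "{0<..<T} \<inter> \<rat>"] unfolding cl by blast
  qed
qed

section \<open>Joint measurability and square integrability on the product of time and sample
  space\<close>

lemma measurable_restrict_lborel_pair:
  assumes "progressively_measurable F T f" "t \<in> {0..T}"
  shows "(\<lambda>(s, \<omega>). f s \<omega>) \<in> borel_measurable (restrict_space lborel {0..t} \<Otimes>\<^sub>M F t)"
proof -
  have "sets (restrict_space borel {0..t} \<Otimes>\<^sub>M F t) = sets (restrict_space lborel {0..t} \<Otimes>\<^sub>M F t)"
    by (intro sets_pair_measure_cong sets_restrict_space_cong) auto
  from measurable_cong_sets[OF this refl] show ?thesis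
    using assms unfolding progressively_measurable_def by blast
qed

lemma progressively_measurable_at:
  assumes "progressively_measurable F T f" "t \<in> {0..T}"
  shows "f t \<in> borel_measurable (F t)"
proof -
  have "(\<lambda>\<omega>. (\<lambda>(s, \<omega>). f s \<omega>) (t, \<omega>)) \<in> borel_measurable (F t)"
    using assms(2)
    by (intro measurable_compose[OF measurable_Pair1' measurable_restrict_lborel_pair[OF assms]])
       (simp add: space_restrict_space)
  then show ?thesis by simp
qed

lemma sigma_finite_time: "sigma_finite_measure (restrict_space lborel {0..t :: real})"
  by (rule sigma_finite_measure_restrict_space) (auto intro: sigma_finite_lborel)

text \<open>Here progressive measurability enters: joint measurability on \<open>{0..t}\<close>
  relative to \<open>F t\<close> makes the time integral a variable known at \<open>t\<close>, hence
  an admissible test variable for orthogonal increments.\<close>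

lemma set_integral_measurable_F:
  assumes "progressively_measurable F T f" "t \<in> {0..T}"
  shows "(\<lambda>\<omega>. LBINT s:{0..t}. f s \<omega>) \<in> borel_measurable (F t)"
proof -
  interpret R: sigma_finite_measure "restrict_space lborel {0..t}" by (rule sigma_finite_time)
  have "(\<lambda>\<omega>. \<integral>s. f s \<omega> \<partial>restrict_space lborel {0..t}) \<in> borel_measurable (F t)"
    using measurable_pair_swap[OF measurable_restrict_lborel_pair[OF assms]]
    by (intro R.borel_measurable_lebesgue_integral) (simp add: split_beta')
  moreover have "(\<integral>s. f s \<omega> \<partial>restrict_space lborel {0..t}) = (LBINT s:{0..t}. f s \<omega>)" for \<omega>
    by (simp add: set_lebesgue_integral_def integral_restrict_space)
  ultimately show ?thesis by simp
qed

abbreviation time_measure :: "real measure" where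
  "time_measure \<equiv> restrict_space lborel {0..T}"

lemma measurable_time_pair:
  assumes "progressively_measurable F T f"
  shows "(\<lambda>(s, \<omega>). f s \<omega>) \<in> borel_measurable (time_measure \<Otimes>\<^sub>M M)"
proof -
  have "(\<lambda>x. x) \<in> M \<rightarrow>\<^sub>M F T"
    by (rule measurable_from_subalg[OF subalg measurable_ident_sets[OF refl]]) (use T_pos in auto)
  then have id: "(\<lambda>x. (fst x, snd x)) \<in> time_measure \<Otimes>\<^sub>M M \<rightarrow>\<^sub>M time_measure \<Otimes>\<^sub>M F T"
    by (intro measurable_Pair measurable_fst measurable_compose[OF measurable_snd])
  have "T \<in> {0..T}" using T_pos by simp
  from measurable_compose[OF id measurable_restrict_lborel_pair[OF assms this]]
  show ?thesis by simp
qed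

lemma L2_dist_zero_eq:
  "L2_dist M T f (\<lambda>t \<omega>. 0) = (\<integral>\<^sup>+\<omega>. \<integral>\<^sup>+s. ennreal ((f s \<omega>)\<^sup>2) \<partial>time_measure \<partial>M)"
  unfolding L2_dist_def by (simp add: nn_integral_restrict_space)

lemma square_integrable_progressive_lincomb:
  assumes "square_integrable_progressive M F T f" "square_integrable_progressive M F T g"
  shows "square_integrable_progressive M F T (\<lambda>t \<omega>. \<alpha> * f t \<omega> + \<beta> * g t \<omega>)"
proof -
  have pf: "progressively_measurable F T f" and pg: "progressively_measurable F T g"
    and Lf: "L2_dist M T f (\<lambda>t \<omega>. 0) < \<infinity>" and Lg: "L2_dist M T g (\<lambda>t \<omega>. 0) < \<infinity>"
    using assms by (auto simp: square_integrable_progressive_def)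
  interpret R: sigma_finite_measure time_measure by (rule sigma_finite_time)
  note [measurable] = measurable_time_pair[OF pf] measurable_time_pair[OF pg]
  have "progressively_measurable F T (\<lambda>t \<omega>. \<alpha> * f t \<omega> + \<beta> * g t \<omega>)"
    using pf pg unfolding progressively_measurable_def split_beta'
    by (auto intro!: borel_measurable_add borel_measurable_times)
  moreover have "L2_dist M T (\<lambda>t \<omega>. \<alpha> * f t \<omega> + \<beta> * g t \<omega>) (\<lambda>t \<omega>. 0) < \<infinity>"
  proof -
    have pt: "ennreal ((\<alpha> * x + \<beta> * y)\<^sup>2) \<le> ennreal (2 * \<alpha>\<^sup>2) * ennreal (x\<^sup>2) + ennreal (2 * \<beta>\<^sup>2) * ennreal (y\<^sup>2)"
      for x y :: real
    proof -
      have "(\<alpha> * x + \<beta> * y)\<^sup>2 \<le> 2 * \<alpha>\<^sup>2 * x\<^sup>2 + 2 * \<beta>\<^sup>2 * y\<^sup>2"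
        using sum_squares_bound[of "\<alpha> * x" "\<beta> * y"] by (simp add: power2_sum power_mult_distrib)
      then show ?thesis
        by (simp flip: ennreal_mult ennreal_plus)
    qed
    have "L2_dist M T (\<lambda>t \<omega>. \<alpha> * f t \<omega> + \<beta> * g t \<omega>) (\<lambda>t \<omega>. 0) \<le>
      (\<integral>\<^sup>+\<omega>. \<integral>\<^sup>+s. ennreal (2 * \<alpha>\<^sup>2) * ennreal ((f s \<omega>)\<^sup>2) + ennreal (2 * \<beta>\<^sup>2) * ennreal ((g s \<omega>)\<^sup>2) \<partial>time_measure \<partial>M)"
      unfolding L2_dist_zero_eq by (intro nn_integral_mono pt)
    also have "\<dots> = (\<integral>\<^sup>+\<omega>. ennreal (2 * \<alpha>\<^sup>2) * (\<integral>\<^sup>+s. ennreal ((f s \<omega>)\<^sup>2) \<partial>time_measure)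
        + ennreal (2 * \<beta>\<^sup>2) * (\<integral>\<^sup>+s. ennreal ((g s \<omega>)\<^sup>2) \<partial>time_measure) \<partial>M)"
      by (intro nn_integral_cong) (simp add: nn_integral_add nn_integral_cmult)
    also have "\<dots> = ennreal (2 * \<alpha>\<^sup>2) * L2_dist M T f (\<lambda>t \<omega>. 0) + ennreal (2 * \<beta>\<^sup>2) * L2_dist M T g (\<lambda>t \<omega>. 0)"
      unfolding L2_dist_zero_eq by (simp add: nn_integral_add nn_integral_cmult)
    also have "\<dots> < \<infinity>"
      using Lf Lg by (simp add: ennreal_mult_less_top)
    finally show ?thesis .
  qed
  ultimately show ?thesis by (simp add: square_integrable_progressive_def)
qed

lemma AE_sqint_time:
  assumes "square_integrable_progressive M F T f"
  shows "AE \<omega> in M. sqint time_measure (\<lambda>s. f s \<omega>)"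
proof -
  have pf: "progressively_measurable F T f" and Lf: "L2_dist M T f (\<lambda>t \<omega>. 0) < \<infinity>"
    using assms by (auto simp: square_integrable_progressive_def)
  interpret R: sigma_finite_measure time_measure by (rule sigma_finite_time)
  note [measurable] = measurable_time_pair[OF pf]
  have "AE \<omega> in M. (\<integral>\<^sup>+s. ennreal ((f s \<omega>)\<^sup>2) \<partial>time_measure) \<noteq> \<infinity>"
    using Lf unfolding L2_dist_zero_eq by (intro nn_integral_PInf_AE) auto
  with AE_space show ?thesis
  proof eventually_elim
    case (elim \<omega>)
    then show ?case
      by (intro nn_integral_square_finite_imp_sqint) (auto simp: less_top)
  qed
qed

text \<open>
  A continuous process of bounded variation whose increments are orthogonal to the past vanishes:
  over a partition of mesh \<open>\<delta>\<close>, the second moment of \<open>\<integral> f\<close> is the sum of the second moments of its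
  increments, and by Cauchy-Schwarz that sum is at most \<open>\<delta>\<close> times the second moment of \<open>f\<close>.
\<close>

lemma set_integral_orthogonal_increments_zero:
  assumes sip: "square_integrable_progressive M F T f"
    and N: "orthogonal_increments N"
    and eq: "\<And>t. t \<in> {0..T} \<Longrightarrow> AE \<omega> in M. (LBINT s:{0..t}. f s \<omega>) = - N t \<omega>"
    and u: "u \<in> {0..T}"
  shows "AE \<omega> in M. (LBINT s:{0..u}. f s \<omega>) = 0"
proof -
  have pf: "progressively_measurable F T f" and Lf: "L2_dist M T f (\<lambda>t \<omega>. 0) < \<infinity>"
    using sip by (auto simp: square_integrable_progressive_def)
  interpret R: finite_measure time_measure
    by (rule finite_measureI) (simp add: space_restrict_space emeasure_restrict_space emeasure_lborel_Icc_eq)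
  note [measurable] = measurable_time_pair[OF pf]
  define G where "G = (\<lambda>t \<omega>. LBINT s:{0..t}. f s \<omega>)"
  \<comment> \<open>The energy of the path up to \<open>t\<close>. It is additive in time, so its
    increments telescope along a partition.\<close>
  define m where "m = (\<lambda>t \<omega>. \<integral>s. (f s \<omega>)\<^sup>2 * indicator {0..t} s \<partial>time_measure)"
  have G_eq: "G t \<omega> = (\<integral>s. f s \<omega> * indicator {0..t} s \<partial>time_measure)" if "t \<in> {0..T}" for t \<omega>
  proof -
    have "(\<lambda>s. indicator {0..T} s *\<^sub>R (f s \<omega> * indicator {0..t} s)) = (\<lambda>s. indicator {0..t} s *\<^sub>R f s \<omega>)"
      using that by (auto simp: indicator_def)
    then show ?thesis
      unfolding G_def set_lebesgue_integral_def by (subst integral_restrict_space) simp_all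
  qed
  have GF: "G t \<in> borel_measurable (F t)" if "t \<in> {0..T}" for t
    unfolding G_def by (rule set_integral_measurable_F[OF pf that])
  have GM: "G t \<in> borel_measurable M" if "t \<in> {0..T}" for t
    using measurable_F_imp_M[OF _ GF[OF that]] that by simp
  have G: "sqint M (G t)" if "t \<in> {0..T}" for t
  proof (rule sqint_AE_cong[OF _ GM[OF that]])
    show "sqint M (\<lambda>\<omega>. - 1 * N t \<omega>)"
      using N that by (intro sqint_cmult) (auto simp: orthogonal_increments_def)
    show "AE \<omega> in M. - 1 * N t \<omega> = G t \<omega>"
      using eq[OF that] by (auto simp: G_def)
  qed
  have ind [measurable]: "(\<lambda>s. indicator A s :: real) \<in> borel_measurable time_measure"
    if "A \<in> sets borel" for A :: "real set"
    by (rule measurable_restrict_space1) (use that in simp)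
  have int_ind: "integrable time_measure (\<lambda>s. h s * indicator A s)"
    if "integrable time_measure h" "A \<in> sets borel" for h :: "real \<Rightarrow> real" and A
    by (rule Bochner_Integration.integrable_bound[OF that(1)])
       (use that ind in \<open>auto simp: indicator_def\<close>)
  have f2: "integrable time_measure (\<lambda>s. (f s \<omega>)\<^sup>2 * indicator A s)"
    if "sqint time_measure (\<lambda>s. f s \<omega>)" "A \<in> sets borel" for \<omega> A
    by (rule int_ind[OF sqint_integrable_square[OF that(1)] that(2)])
  have m_int: "integrable M (m t)" for t
  proof (rule integrableI_bounded)
    show "m t \<in> borel_measurable M"
      unfolding m_def by measurable
    have "(\<integral>\<^sup>+\<omega>. ennreal (norm (m t \<omega>)) \<partial>M) \<le> L2_dist M T f (\<lambda>t \<omega>. 0)"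
      unfolding L2_dist_zero_eq
    proof (rule nn_integral_mono_AE)
      show "AE \<omega> in M. ennreal (norm (m t \<omega>)) \<le> (\<integral>\<^sup>+s. ennreal ((f s \<omega>)\<^sup>2) \<partial>time_measure)"
        using AE_sqint_time[OF sip]
      proof eventually_elim
        case (elim \<omega>)
        have "norm (m t \<omega>) = m t \<omega>"
          by (simp add: m_def)
        also have "\<dots> \<le> (\<integral>s. (f s \<omega>)\<^sup>2 \<partial>time_measure)"
          unfolding m_def using f2[OF elim, of "{0..t}"] sqint_integrable_square[OF elim]
          by (intro integral_mono) (auto simp: indicator_def)
        finally show ?case
          unfolding sqint_nn_integral[OF elim] by (rule ennreal_leI)
      qed
    qed
    then show "(\<integral>\<^sup>+\<omega>. ennreal (norm (m t \<omega>)) \<partial>M) < \<infinity>"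
      using Lf by (rule le_less_trans)
  qed
  have incr: "expectation (\<lambda>\<omega>. (G t \<omega> - G s \<omega>)\<^sup>2) \<le> (t - s) * (expectation (m t) - expectation (m s))"
    if st: "0 \<le> s" "s \<le> t" "t \<le> T" for s t
  proof -
    have ae: "AE \<omega> in M. (G t \<omega> - G s \<omega>)\<^sup>2 \<le> (t - s) * (m t \<omega> - m s \<omega>)"
      using AE_sqint_time[OF sip]
    proof eventually_elim
      case (elim \<omega>)
      have st': "s \<in> {0..T}" "t \<in> {0..T}" using st by auto
      have f1: "integrable time_measure (\<lambda>r. f r \<omega> * indicator A r)" if "A \<in> sets borel" for A
        by (rule int_ind[OF R.sqint_integrable[OF elim] that])
      let ?i = "\<lambda>r. indicator {s<..t} r :: real"
      have i: "sqint time_measure ?i"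
        using sqint_bounded_mult[of ?i time_measure 1 "\<lambda>_. 1"] ind[of "{s<..t}"]
        by (simp add: sqint_def[of time_measure "\<lambda>_. 1"])
      have "(\<lambda>r. indicator {0..T} r * (?i r)\<^sup>2) = ?i"
        using st by (auto simp: indicator_def)
      then have ii: "(\<integral>r. (?i r)\<^sup>2 \<partial>time_measure) = t - s"
        using st by (simp add: integral_restrict_space)
      have fi: "sqint time_measure (\<lambda>r. ?i r * f r \<omega>)"
        by (rule sqint_bounded_mult[OF ind _ elim, of _ 1]) auto
      have "G t \<omega> - G s \<omega> = (\<integral>r. f r \<omega> * indicator {0..t} r - f r \<omega> * indicator {0..s} r \<partial>time_measure)"
        unfolding G_eq[OF st'(1)] G_eq[OF st'(2)] using f1 by simp
      also have "\<dots> = (\<integral>r. (?i r * f r \<omega>) * ?i r \<partial>time_measure)"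
        by (intro Bochner_Integration.integral_cong refl) (use st in \<open>auto simp: indicator_def\<close>)
      finally have "(G t \<omega> - G s \<omega>)\<^sup>2 \<le> (\<integral>r. (?i r * f r \<omega>)\<^sup>2 \<partial>time_measure) * (t - s)"
        using sqint_Cauchy_Schwarz[OF fi i] by (simp add: ii)
      also have "(\<integral>r. (?i r * f r \<omega>)\<^sup>2 \<partial>time_measure) =
          (\<integral>r. (f r \<omega>)\<^sup>2 * indicator {0..t} r - (f r \<omega>)\<^sup>2 * indicator {0..s} r \<partial>time_measure)"
        by (intro Bochner_Integration.integral_cong refl) (use st in \<open>auto simp: indicator_def\<close>)
      also have "\<dots> = m t \<omega> - m s \<omega>"
        unfolding m_def using f2[OF elim] by simp
      finally show ?case by (simp add: mult.commute)
    qed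
    have "expectation (\<lambda>\<omega>. (G t \<omega> - G s \<omega>)\<^sup>2) \<le> expectation (\<lambda>\<omega>. (t - s) * (m t \<omega> - m s \<omega>))"
      using st by (intro integral_mono_AE ae sqint_integrable_square sqint_diff G) (auto simp: m_int)
    then show ?thesis by (simp add: m_int)
  qed
  have step: "expectation (\<lambda>\<omega>. (G t \<omega>)\<^sup>2)
      \<le> expectation (\<lambda>\<omega>. (G s \<omega>)\<^sup>2) + (t - s) * (expectation (m t) - expectation (m s))"
    if st: "0 \<le> s" "s \<le> t" "t \<le> T" for s t
  proof -
    have st': "s \<in> {0..T}" "t \<in> {0..T}" using st by auto
    have [measurable]: "G s \<in> borel_measurable M" "G t \<in> borel_measurable M"
      "N s \<in> borel_measurable M" "N t \<in> borel_measurable M"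
      using GM st' N by (auto simp: orthogonal_increments_def sqint_def)
    \<comment> \<open>The increment is rewritten through \<open>N\<close>, but the factor
      \<open>G s\<close> is kept: it is known to be \<open>F s\<close>-measurable, which
      \<open>N s\<close> is not.\<close>
    have "expectation (\<lambda>\<omega>. (G t \<omega> - G s \<omega>) * G s \<omega>) = expectation (\<lambda>\<omega>. - ((N t \<omega> - N s \<omega>) * G s \<omega>))"
    proof (rule integral_cong_AE)
      show "AE \<omega> in M. (G t \<omega> - G s \<omega>) * G s \<omega> = - ((N t \<omega> - N s \<omega>) * G s \<omega>)"
        using eq[OF st'(1)] eq[OF st'(2)]
        by eventually_elim (simp add: G_def algebra_simps)
    qed measurable
    also have "\<dots> = 0"
      using N st G[OF st'(1)] GF[OF st'(1)] by (auto simp: orthogonal_increments_def)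
    finally have cross: "expectation (\<lambda>\<omega>. (G t \<omega> - G s \<omega>) * G s \<omega>) = 0" .
    have "expectation (\<lambda>\<omega>. (G t \<omega>)\<^sup>2)
      = expectation (\<lambda>\<omega>. (G s \<omega>)\<^sup>2 + 2 * ((G t \<omega> - G s \<omega>) * G s \<omega>) + (G t \<omega> - G s \<omega>)\<^sup>2)"
      by (simp add: power2_eq_square algebra_simps)
    also have "\<dots> = expectation (\<lambda>\<omega>. (G s \<omega>)\<^sup>2) + expectation (\<lambda>\<omega>. (G t \<omega> - G s \<omega>)\<^sup>2)"
      using sqint_integrable_square[OF G[OF st'(1)]] cross
        sqint_integrable_mult[OF sqint_diff[OF G[OF st'(2)] G[OF st'(1)]] G[OF st'(1)]]
        sqint_integrable_square[OF sqint_diff[OF G[OF st'(2)] G[OF st'(1)]]]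
      by (simp del: integral_mult_right_zero add: Bochner_Integration.integral_mult_right)
    finally show ?thesis using incr[OF st] by simp
  qed
  have bound: "expectation (\<lambda>\<omega>. (G u \<omega>)\<^sup>2) \<le> (u * expectation (m u)) / real n" if n: "0 < n" for n :: nat
  proof -
    \<comment> \<open>All pieces have length \<open>u / n\<close>, so the bounds of
      \<open>step\<close> telescope in \<open>m\<close>. The induction starts from
      \<open>G 0 = 0\<close>, an integral over a single point.\<close>
    let ?t = "\<lambda>i. u * real i / real n"
    have "expectation (\<lambda>\<omega>. (G (?t i) \<omega>)\<^sup>2) \<le> (u / real n) * (expectation (m (?t i)))" if "i \<le> n" for i
      using that
    proof (induction i)
      case 0
      have "G 0 \<omega> = 0" for \<omega>
        unfolding G_def set_lebesgue_integral_def
        by (rule integral_eq_zero_AE, rule AE_mp[OF AE_lborel_singleton[of 0]]) (auto simp: indicator_def)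
      then show ?case using u by (simp add: m_def)
    next
      case (Suc i)
      have "?t i \<le> ?t (Suc i)"
        using u by (intro divide_right_mono mult_left_mono) auto
      moreover have "?t (Suc i) \<le> u"
        using u Suc.prems n mult_left_mono[of "real (Suc i)" "real n" u] by (simp add: pos_divide_le_eq)
      ultimately have "expectation (\<lambda>\<omega>. (G (?t (Suc i)) \<omega>)\<^sup>2) \<le> expectation (\<lambda>\<omega>. (G (?t i) \<omega>)\<^sup>2)
        + (?t (Suc i) - ?t i) * (expectation (m (?t (Suc i))) - expectation (m (?t i)))"
        using u by (intro step) auto
      moreover have "?t (Suc i) - ?t i = u / real n"
        by (simp add: distrib_left add_divide_distrib)
      ultimately show ?case
        using Suc by (simp add: right_diff_distrib)
    qed
    from this[of n] n show ?thesis by simp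
  qed
  have "(\<lambda>n. (u * expectation (m u)) / real n) \<longlonglongrightarrow> 0"
    by (rule lim_const_over_n)
  then have "expectation (\<lambda>\<omega>. (G u \<omega>)\<^sup>2) \<le> 0"
    by (rule LIMSEQ_le_const) (use bound in \<open>auto intro!: exI[of _ 1]\<close>)
  then have "expectation (\<lambda>\<omega>. (G u \<omega>)\<^sup>2) = 0"
    by (simp add: antisym)
  then have "AE \<omega> in M. (G u \<omega>)\<^sup>2 = 0"
    using integral_nonneg_eq_0_iff_AE[OF sqint_integrable_square[OF G[OF u]]] by simp
  then show ?thesis by (simp add: G_def)
qed

section \<open>Continuous square integrable drifts\<close>

text \<open>The stochastic integral is replaced by any \<open>N\<close> with orthogonal increments,
  so that linear combinations stay in the class without combining integrands. Continuity of the
  drift lets it be identified at every time rather than almost every time.\<close>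

definition ito_drift :: "(real \<Rightarrow> 'w \<Rightarrow> real) \<Rightarrow> (real \<Rightarrow> 'w \<Rightarrow> real) \<Rightarrow> bool" where
  "ito_drift X f \<longleftrightarrow> square_integrable_progressive M F T f \<and>
     (AE \<omega> in M. continuous_on {0..T} (\<lambda>t. f t \<omega>)) \<and>
     (\<exists>N. orthogonal_increments N \<and>
       (AE \<omega> in M. \<forall>t\<in>{0..T}. X t \<omega> = X 0 \<omega> + (LBINT s:{0..t}. f s \<omega>) + N t \<omega>))"

lemma ito_drift_lincomb:
  assumes "ito_drift X f" "ito_drift Y g"
  shows "ito_drift (\<lambda>t \<omega>. \<alpha> * X t \<omega> + \<beta> * Y t \<omega>) (\<lambda>t \<omega>. \<alpha> * f t \<omega> + \<beta> * g t \<omega>)"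
proof -
  from assms have f: "AE \<omega> in M. continuous_on {0..T} (\<lambda>t. f t \<omega>)"
    and g: "AE \<omega> in M. continuous_on {0..T} (\<lambda>t. g t \<omega>)"
    by (auto simp: ito_drift_def)
  from assms obtain N N' where N: "orthogonal_increments N" "orthogonal_increments N'"
    and X: "AE \<omega> in M. \<forall>t\<in>{0..T}. X t \<omega> = X 0 \<omega> + (LBINT s:{0..t}. f s \<omega>) + N t \<omega>"
    and Y: "AE \<omega> in M. \<forall>t\<in>{0..T}. Y t \<omega> = Y 0 \<omega> + (LBINT s:{0..t}. g s \<omega>) + N' t \<omega>"
    by (auto simp: ito_drift_def)
  let ?h = "\<lambda>t \<omega>. \<alpha> * f t \<omega> + \<beta> * g t \<omega>" and ?Z = "\<lambda>t \<omega>. \<alpha> * X t \<omega> + \<beta> * Y t \<omega>"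
    and ?N = "\<lambda>t \<omega>. \<alpha> * N t \<omega> + \<beta> * N' t \<omega>"
  have "AE \<omega> in M. \<forall>t\<in>{0..T}. ?Z t \<omega> = ?Z 0 \<omega> + (LBINT s:{0..t}. ?h s \<omega>) + ?N t \<omega>"
    using f g X Y
  proof eventually_elim
    case (elim \<omega>)
    show ?case
    proof
      fix t assume t: "t \<in> {0..T}"
      have "set_integrable lborel {0..t} (\<lambda>s. f s \<omega>)" "set_integrable lborel {0..t} (\<lambda>s. g s \<omega>)"
        using t elim(1,2) by (auto intro!: borel_integrable_atLeastAtMost' elim: continuous_on_subset)
      then have "(LBINT s:{0..t}. ?h s \<omega>) = \<alpha> * (LBINT s:{0..t}. f s \<omega>) + \<beta> * (LBINT s:{0..t}. g s \<omega>)"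
        by (simp add: set_integral_add)
      with bspec[OF elim(3) t] bspec[OF elim(4) t] show "?Z t \<omega> = ?Z 0 \<omega> + (LBINT s:{0..t}. ?h s \<omega>) + ?N t \<omega>"
        by (simp add: algebra_simps)
    qed
  qed
  moreover have "AE \<omega> in M. continuous_on {0..T} (\<lambda>t. ?h t \<omega>)"
    using f g by eventually_elim (intro continuous_intros)
  moreover have "square_integrable_progressive M F T ?h"
    using assms by (intro square_integrable_progressive_lincomb) (auto simp: ito_drift_def)
  ultimately show ?thesis
    unfolding ito_drift_def using orthogonal_increments_lincomb[OF N] by blast
qed

text \<open>Uniqueness of the decomposition into drift and martingale part. By linearity the zero
  process is the only case to treat: two processes are compared through their difference.\<close>

lemma ito_drift_zero:
  assumes X: "ito_drift X f" and zero: "AE \<omega> in M. \<forall>t\<in>{0..T}. X t \<omega> = 0"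
  shows "AE \<omega> in M. \<forall>t\<in>{0..T}. f t \<omega> = 0"
proof -
  from X obtain N where sip: "square_integrable_progressive M F T f"
    and cont: "AE \<omega> in M. continuous_on {0..T} (\<lambda>t. f t \<omega>)"
    and N: "orthogonal_increments N"
    and eq: "AE \<omega> in M. \<forall>t\<in>{0..T}. X t \<omega> = X 0 \<omega> + (LBINT s:{0..t}. f s \<omega>) + N t \<omega>"
    by (auto simp: ito_drift_def)
  have G: "AE \<omega> in M. (LBINT s:{0..t}. f s \<omega>) = - N t \<omega>" if "t \<in> {0..T}" for t
    using eq zero
  proof eventually_elim
    case (elim \<omega>)
    have "X t \<omega> = 0" "X 0 \<omega> = 0" using elim(2) that T_pos by auto
    with bspec[OF elim(1) that] show ?case by simp
  qed
  have "AE \<omega> in M. \<forall>t\<in>{0..T}. (LBINT s:{0..t}. f s \<omega>) = 0"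
  proof (rule AE_continuous_zero)
    show "AE \<omega> in M. continuous_on {0..T} (\<lambda>t. LBINT s:{0..t}. f s \<omega>)"
      using cont
      by eventually_elim (intro continuous_on_set_integral borel_integrable_atLeastAtMost')
  qed (rule set_integral_orthogonal_increments_zero[OF sip N G])
  with cont show ?thesis
    by eventually_elim (use continuous_integral_zero_imp_zero[OF T_pos] in blast)
qed

text \<open>Three terms cover every relation that gets differentiated below; shorter ones are padded
  with coefficient 0.\<close>

lemma ito_drift_zero3:
  assumes "ito_drift X f" "ito_drift Y g" "ito_drift Z h"
    and "AE \<omega> in M. \<forall>t\<in>{0..T}. \<alpha> * X t \<omega> + \<beta> * Y t \<omega> + \<gamma> * Z t \<omega> = 0"
  shows "AE \<omega> in M. \<forall>t\<in>{0..T}. \<alpha> * f t \<omega> + \<beta> * g t \<omega> + \<gamma> * h t \<omega> = 0"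
  using ito_drift_zero[OF ito_drift_lincomb[OF ito_drift_lincomb[OF assms(1,2)] assms(3)], of 1 \<alpha> \<beta> \<gamma>]
    assms(4) by simp

section \<open>From Ito differentials to drifts\<close>

lemma has_ito_differential_continuous:
  assumes "has_ito_differential M F W T X f H"
  shows "AE \<omega> in M. continuous_on {0..T} (\<lambda>t. X t \<omega>)"
proof -
  from assms obtain I where "has_ito_integral M F W T H I"
    and eq: "AE \<omega> in M. set_integrable lborel {0..T} (\<lambda>s. f s \<omega>) \<and>
          (\<forall>t\<in>{0..T}. X t \<omega> = X 0 \<omega> + (LBINT s:{0..t}. f s \<omega>) + I t \<omega>)"
    by (auto simp: has_ito_differential_def)
  then have "AE \<omega> in M. continuous_on {0..T} (\<lambda>t. I t \<omega>)"
    by (auto simp: has_ito_integral_def)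
  with eq show ?thesis
  proof eventually_elim
    case (elim \<omega>)
    have "continuous_on {0..T} (\<lambda>t. X 0 \<omega> + (LBINT s:{0..t}. f s \<omega>) + I t \<omega>)"
      using elim by (intro continuous_intros continuous_on_set_integral) auto
    then show ?case
      by (rule continuous_on_eq) (use elim(1) in \<open>metis\<close>)
  qed
qed

lemma has_ito_differential_drift:
  assumes "has_ito_differential M F W T X f H" "square_integrable_progressive M F T f"
    and "AE \<omega> in M. continuous_on {0..T} (\<lambda>t. f t \<omega>)"
  shows "ito_drift X f"
proof -
  from assms(1) obtain I where I: "has_ito_integral M F W T H I"
    and eq: "AE \<omega> in M. set_integrable lborel {0..T} (\<lambda>s. f s \<omega>) \<and>
          (\<forall>t\<in>{0..T}. X t \<omega> = X 0 \<omega> + (LBINT s:{0..t}. f s \<omega>) + I t \<omega>)"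
    by (auto simp: has_ito_differential_def)
  from eq have "AE \<omega> in M. \<forall>t\<in>{0..T}. X t \<omega> = X 0 \<omega> + (LBINT s:{0..t}. f s \<omega>) + I t \<omega>"
    by eventually_elim blast
  with orthogonal_increments_ito_integral[OF I] assms(2,3) show ?thesis
    unfolding ito_drift_def by blast
qed

lemma has_ito_differential_const_diffusion_zero:
  assumes X: "has_ito_differential M F W T X f (\<lambda>t \<omega>. D)"
    and X0: "AE \<omega> in M. \<forall>t\<in>{0..T}. X t \<omega> = 0" and f0: "AE \<omega> in M. \<forall>t\<in>{0..T}. f t \<omega> = 0"
  shows "D = 0"
proof -
  from X obtain I where I: "has_ito_integral M F W T (\<lambda>t \<omega>. D) I"
    and eq: "AE \<omega> in M. set_integrable lborel {0..T} (\<lambda>s. f s \<omega>) \<and>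
          (\<forall>t\<in>{0..T}. X t \<omega> = X 0 \<omega> + (LBINT s:{0..t}. f s \<omega>) + I t \<omega>)"
    by (auto simp: has_ito_differential_def)
  have "AE \<omega> in M. I T \<omega> = 0"
    using eq X0 f0
  proof eventually_elim
    case (elim \<omega>)
    have "(LBINT s:{0..T}. f s \<omega>) = (LBINT s:{0..T}. 0)"
      by (rule set_lebesgue_integral_cong) (use elim(3) in auto)
    moreover have "X T \<omega> = 0" "X 0 \<omega> = 0" "T \<in> {0..T}" using elim(2) T_pos by auto
    ultimately show ?case using bspec[OF conjunct2[OF elim(1)], of T] by simp
  qed
  from ito_integral_const_zero_imp[OF I this] show ?thesis .
qed

end


section \<open>The two adjoint processes differ\<close>

text \<open>The nondegeneracy hypotheses exclude cases of coincidence. If \<open>c = 0\<close>, then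
  \<open>Pbar\<close> drops out of the equation of \<open>P0\<close>; if \<open>a = 0\<close>, then
  \<open>Pbar\<close> has no drift and terminal value zero, hence vanishes; either way
  \<open>P0\<close> satisfies the second system. If \<open>q = 0\<close>, the adjoint equations are
  homogeneous and all adjoint processes vanish. If \<open>D0\<close>, \<open>x00\<close> and
  \<open>x0\<close> are all zero, the zero processes solve both systems.\<close>

theorem proposition6p2:
  fixes M :: "'w measure"
    and F :: "real \<Rightarrow> 'w measure"
    and W :: "real \<Rightarrow> 'w \<Rightarrow> real"
    and T a b c q D0 x00 x0 :: real
    and X0 Xbar P0 Pbar Q00 Q10 :: "real \<Rightarrow> 'w \<Rightarrow> real"
    and X0' Xbar' Y0 Z0 :: "real \<Rightarrow> 'w \<Rightarrow> real"
  assumes "wiener_process M F W"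
    and "T > 0"
    and "a \<noteq> 0" and "c \<noteq> 0" and "q \<noteq> 0"
    and "D0 \<noteq> 0 \<or> x00 \<noteq> 0 \<or> x0 \<noteq> 0"
    and "conditional_mkv_solution M F W T a b c q D0 x00 x0 X0 Xbar P0 Pbar Q00 Q10"
    and "exogenous_mean_solution M F W T a b c q D0 x00 x0 X0' Xbar' Y0 Z0"
  shows "\<exists>t\<in>{0..T}. \<exists>E\<in>sets M. measure M E > 0 \<and> (\<forall>\<omega>\<in>E. P0 t \<omega> \<noteq> Y0 t \<omega>)"
proof (rule ccontr)
  assume contra: "\<not> ?thesis"
  interpret prob_space M
    using assms(1) by (simp add: wiener_process_def)
  interpret wiener_setting M F W T
    by unfold_locales (use assms in auto)
  note s1 = assms(7)[unfolded conditional_mkv_solution_def]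
  note s2 = assms(8)[unfolded exogenous_mean_solution_def]
  have sip: "square_integrable_progressive M F T X0" "square_integrable_progressive M F T Xbar"
    "square_integrable_progressive M F T P0" "square_integrable_progressive M F T Pbar"
    "square_integrable_progressive M F T X0'" "square_integrable_progressive M F T Xbar'"
    "square_integrable_progressive M F T Y0"
    using s1 s2 by auto
  have dX0: "has_ito_differential M F W T X0 (\<lambda>t \<omega>. a * Xbar t \<omega> - 1/2 * b\<^sup>2 * P0 t \<omega>) (\<lambda>t \<omega>. D0)"
    and dXbar: "has_ito_differential M F W T Xbar (\<lambda>t \<omega>. c * X0 t \<omega>) (\<lambda>t \<omega>. 0)"
    and dP0: "has_ito_differential M F W T P0 (\<lambda>t \<omega>. - (2 * q * X0 t \<omega> + c * Pbar t \<omega>)) Q00"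
    and dPbar: "has_ito_differential M F W T Pbar (\<lambda>t \<omega>. - a * P0 t \<omega>) Q10"
    and init: "AE \<omega> in M. X0 0 \<omega> = x00 \<and> Xbar 0 \<omega> = x0 \<and> P0 T \<omega> = 0 \<and> Pbar T \<omega> = 0"
    using s1 by auto
  have dX0': "has_ito_differential M F W T X0' (\<lambda>t \<omega>. a * Xbar' t \<omega> - 1/2 * b\<^sup>2 * Y0 t \<omega>) (\<lambda>t \<omega>. D0)"
    and dXbar': "has_ito_differential M F W T Xbar' (\<lambda>t \<omega>. c * X0' t \<omega>) (\<lambda>t \<omega>. 0)"
    and dY0: "has_ito_differential M F W T Y0 (\<lambda>t \<omega>. - 2 * q * X0' t \<omega>) Z0"
    using s2 by auto
  note cont = dX0[THEN has_ito_differential_continuous] dXbar[THEN has_ito_differential_continuous]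
    dP0[THEN has_ito_differential_continuous] dPbar[THEN has_ito_differential_continuous]
    dX0'[THEN has_ito_differential_continuous] dXbar'[THEN has_ito_differential_continuous]
    dY0[THEN has_ito_differential_continuous]
  \<comment> \<open>Every drift in the two systems has this form, with \<open>\<beta> = 0\<close>
    when only one process occurs.\<close>
  have drift: "ito_drift X (\<lambda>t \<omega>. \<alpha> * f t \<omega> + \<beta> * g t \<omega>)"
    if X: "has_ito_differential M F W T X (\<lambda>t \<omega>. \<alpha> * f t \<omega> + \<beta> * g t \<omega>) H"
      and fg: "square_integrable_progressive M F T f" "square_integrable_progressive M F T g"
      and cf: "AE \<omega> in M. continuous_on {0..T} (\<lambda>t. f t \<omega>)"
      and cg: "AE \<omega> in M. continuous_on {0..T} (\<lambda>t. g t \<omega>)"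
    for X f g H \<alpha> \<beta>
  proof (rule has_ito_differential_drift[OF X square_integrable_progressive_lincomb[OF fg]])
    show "AE \<omega> in M. continuous_on {0..T} (\<lambda>t. \<alpha> * f t \<omega> + \<beta> * g t \<omega>)"
      using cf cg by eventually_elim (intro continuous_intros)
  qed
  have driftX0: "ito_drift X0 (\<lambda>t \<omega>. a * Xbar t \<omega> - 1/2 * b\<^sup>2 * P0 t \<omega>)"
    using drift[of X0 a Xbar "- (1/2 * b\<^sup>2)" P0] dX0 sip cont by simp
  have driftXbar: "ito_drift Xbar (\<lambda>t \<omega>. c * X0 t \<omega>)"
    using drift[of Xbar c X0 0 X0] dXbar sip cont by simp
  have driftP0: "ito_drift P0 (\<lambda>t \<omega>. - (2 * q * X0 t \<omega> + c * Pbar t \<omega>))"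
    using drift[of P0 "- (2 * q)" X0 "- c" Pbar] dP0 sip cont by simp
  have driftPbar: "ito_drift Pbar (\<lambda>t \<omega>. - a * P0 t \<omega>)"
    using drift[of Pbar "- a" P0 0 P0] dPbar sip cont by simp
  have driftX0': "ito_drift X0' (\<lambda>t \<omega>. a * Xbar' t \<omega> - 1/2 * b\<^sup>2 * Y0 t \<omega>)"
    using drift[of X0' a Xbar' "- (1/2 * b\<^sup>2)" Y0] dX0' sip cont by simp
  have driftXbar': "ito_drift Xbar' (\<lambda>t \<omega>. c * X0' t \<omega>)"
    using drift[of Xbar' c X0' 0 X0'] dXbar' sip cont by simp
  have driftY0: "ito_drift Y0 (\<lambda>t \<omega>. - 2 * q * X0' t \<omega>)"
    using drift[of Y0 "- 2 * q" X0' 0 X0'] dY0 sip cont by simp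

  \<comment> \<open>The negated claim is applied to the whole set where the two values differ, which
    is measurable and hence null.\<close>
  have "AE \<omega> in M. P0 t \<omega> - Y0 t \<omega> = 0" if t: "t \<in> {0..T}" for t
  proof -
    have [measurable]: "P0 t \<in> borel_measurable M" "Y0 t \<in> borel_measurable M"
      using sip(3,7) t progressively_measurable_at measurable_F_imp_M
      by (auto simp: square_integrable_progressive_def)
    let ?E = "{\<omega> \<in> space M. P0 t \<omega> \<noteq> Y0 t \<omega>}"
    have "?E \<in> sets M" by measurable
    then have "\<not> measure M ?E > 0" using contra t by blast
    then have "prob ?E = 0" by (simp add: zero_less_measure_iff)
    then have "AE \<omega> in M. \<not> P0 t \<omega> \<noteq> Y0 t \<omega>"
      by (subst (asm) prob_eq_0) (auto elim: eventually_mono)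
    then show ?thesis by eventually_elim simp
  qed
  moreover have "AE \<omega> in M. continuous_on {0..T} (\<lambda>t. P0 t \<omega> - Y0 t \<omega>)"
    using cont(3,7) by eventually_elim (intro continuous_intros)
  ultimately have PY: "AE \<omega> in M. \<forall>t\<in>{0..T}. P0 t \<omega> - Y0 t \<omega> = 0"
    by (intro AE_continuous_zero)

  have "AE \<omega> in M. \<forall>t\<in>{0..T}. 1 * P0 t \<omega> + (- 1) * Y0 t \<omega> + 0 * Y0 t \<omega> = 0"
    using PY by simp
  from ito_drift_zero3[OF driftP0 driftY0 driftY0 this]
  have r1: "AE \<omega> in M. \<forall>t\<in>{0..T}. c * Pbar t \<omega> + 2 * q * X0 t \<omega> + (- 2 * q) * X0' t \<omega> = 0"
    by eventually_elim (simp add: algebra_simps)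
  have r2: "AE \<omega> in M. \<forall>t\<in>{0..T}. (- c) * P0 t \<omega> + 2 * q * Xbar t \<omega> + (- 2 * q) * Xbar' t \<omega> = 0"
    using ito_drift_zero3[OF driftPbar driftX0 driftX0' r1] PY
  proof eventually_elim
    case (elim \<omega>)
    show ?case
    proof
      fix t assume t: "t \<in> {0..T}"
      \<comment> \<open>The drift of the left side of \<open>r1\<close> carries an extra
        \<open>- q b\<^sup>2 (P0 - Y0)\<close> from the two controls. \<open>PY\<close> removes it,
        and the common factor \<open>a\<close> is cancelled.\<close>
      have "a * ((- c) * P0 t \<omega> + 2 * q * Xbar t \<omega> + (- 2 * q) * Xbar' t \<omega>) =
        c * (- a * P0 t \<omega>) + 2 * q * (a * Xbar t \<omega> - 1/2 * b\<^sup>2 * P0 t \<omega>)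
          + (- 2 * q) * (a * Xbar' t \<omega> - 1/2 * b\<^sup>2 * Y0 t \<omega>) + q * b\<^sup>2 * (P0 t \<omega> - Y0 t \<omega>)"
        by (simp add: algebra_simps)
      also have "\<dots> = 0" using bspec[OF elim(1) t] bspec[OF elim(2) t] by (simp only: mult_zero_right)
      finally show "(- c) * P0 t \<omega> + 2 * q * Xbar t \<omega> + (- 2 * q) * Xbar' t \<omega> = 0"
        using \<open>a \<noteq> 0\<close> by (metis mult_eq_0_iff)
    qed
  qed
  have X0_zero: "AE \<omega> in M. \<forall>t\<in>{0..T}. X0 t \<omega> = 0"
    using ito_drift_zero3[OF driftP0 driftXbar driftXbar' r2] r1
  proof eventually_elim
    case (elim \<omega>)
    show ?case
    proof
      fix t assume t: "t \<in> {0..T}"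
      \<comment> \<open>The drift of the left side of \<open>r2\<close> is \<open>c\<close> times
        that of \<open>r1\<close> plus \<open>2 q c X0\<close>. The surplus comes from the running
        cost term in the drift of \<open>P0\<close>.\<close>
      have "2 * q * c * X0 t \<omega> = (- c) * (- (2 * q * X0 t \<omega> + c * Pbar t \<omega>)) + 2 * q * (c * X0 t \<omega>)
          + (- 2 * q) * (c * X0' t \<omega>) - c * (c * Pbar t \<omega> + 2 * q * X0 t \<omega> + (- 2 * q) * X0' t \<omega>)"
        by (simp add: algebra_simps)
      also have "\<dots> = 0" using bspec[OF elim(1) t] bspec[OF elim(2) t] by (simp only: mult_zero_right)
      finally show "X0 t \<omega> = 0" using \<open>q \<noteq> 0\<close> \<open>c \<noteq> 0\<close> by simp
    qed
  qed
  note X0_drift_zero = ito_drift_zero[OF driftX0 X0_zero]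
  have Xbar_zero: "AE \<omega> in M. \<forall>t\<in>{0..T}. Xbar t \<omega> = 0"
  \<comment> \<open>For \<open>b = 0\<close> the vanishing drift of \<open>X0\<close> is
    \<open>a Xbar\<close> itself. Otherwise it ties \<open>Xbar\<close> to \<open>P0\<close>; its
    own drift, with \<open>X0 = 0\<close>, forces \<open>Pbar = 0\<close>, the drift of
    \<open>Pbar\<close> then forces \<open>P0 = 0\<close>, and the tie gives
    \<open>Xbar = 0\<close>.\<close>
  proof (cases "b = 0")
    case True
    from X0_drift_zero show ?thesis by eventually_elim (simp add: True \<open>a \<noteq> 0\<close>)
  next
    case False
    have "AE \<omega> in M. \<forall>t\<in>{0..T}. a * Xbar t \<omega> + (- (1/2 * b\<^sup>2)) * P0 t \<omega> + 0 * P0 t \<omega> = 0"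
      using X0_drift_zero by simp
    from ito_drift_zero3[OF driftXbar driftP0 driftP0 this] X0_zero
    have "AE \<omega> in M. \<forall>t\<in>{0..T}. Pbar t \<omega> = 0"
      by eventually_elim (use False \<open>c \<noteq> 0\<close> in auto)
    from ito_drift_zero[OF driftPbar this] X0_drift_zero
    show ?thesis
      by eventually_elim (use \<open>a \<noteq> 0\<close> in auto)
  qed
  have "AE \<omega> in M. x00 = 0 \<and> x0 = 0"
    using X0_zero Xbar_zero init by eventually_elim (use \<open>T > 0\<close> in auto)
  then have "x00 = 0 \<and> x0 = 0" by simp
  moreover have "D0 = 0"
    by (rule has_ito_differential_const_diffusion_zero[OF dX0 X0_zero X0_drift_zero])
  ultimately show False using assms(6) by simp
qed

end
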